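(* Let $K_1,K_2\subset\mathbb{R}$ be regular Cantor sets of class $C^{1+\alpha}$, $\alpha>0$, such that $d=\mathrm{HD}(K_1)+\mathrm{HD}(K_2)>1$. Then for $m$-almost every $\theta\in\mathbb{R}$ the measure $\mu_\theta=(\mathrm{proj}_\theta)_*(m_d|_{K_1\times K_2})$ on $L_\theta$ is absolutely continuous with respect to $m$.
   Context: $\mathrm{HD}$ denotes Hausdorff dimension and $m_d$ is the $d$-dimensional Hausdorff measure, $m_d(K)=\lim_{\varepsilon\to0}\inf\sum_{U\in\mathcal{U}}|U|^d$, the infimum being over (countable) covers $\mathcal{U}$ of $K$ by sets of diameter less than $\varepsilon$, with $|U|$ the diameter of $U$. $m$ denotes Lebesgue measure on $\mathbb{R}$, and also on any line in $\mathbb{R}^2$ through the origin (identified isometrically with $\mathbb{R}$). For $\theta\in\mathbb{R}$, $v_\theta=(\cos\theta,\sin\theta)$, $L_\theta$ is the line in $\mathbb{R}^2$ through the origin containing $v_\theta$, and $\mathrm{proj}_\theta:\mathbb{R}^2\to L_\theta$ is the orthogonal projection; $(\mathrm{proj}_\theta)_*$ denotes push-forward of measures. Regular Cantor sets: $K\subset\mathbb{R}$ is a regular Cantor set of class $C^{1+\alpha}$, $\alpha>0$, if: (i) there are disjoint compact (nondegenerate) intervals $I_1,\dots,I_r\subseteq[0,1]$ such that $K\subset I_1\cup\cdots\cup I_r$ and the boundary of each $I_i$ is contained in $K$; (ii) there is a $C^{1+\alpha}$ expanding map $\psi$ ($|\psi'|>1$) defined in a neighbourhood of $I_1\cup\cdots\cup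 I_r$ such that each $\psi(I_i)$ is the convex hull of a finite union of some of the intervals $I_j$, and such that (ii.1) for each $i\in\{1,\dots,r\}$ and all $n$ sufficiently big, $\psi^n(K\cap I_i)=K$; (ii.2) $K=\bigcap_{n\in\mathbb{N}}\psi^{-n}(I_1\cup\cdots\cup I_r)$, that is, $K$ is the set of points all of whose iterates under $\psi$ remain in $I_1\cup\cdots\cup I_r$. *)

theory Defs
  imports "HOL-Analysis.Analysis"
begin

section \<open>Hausdorff measure and dimension\<close>

text \<open>
  The summand \<open>|U|\<^sup>s\<close>, with the usual convention for \<open>s = 0\<close>: nonempty sets count 1
  (whereas \<open>0 powr 0 = 0\<close> in the library) and the empty set counts 0.
\<close>

definition diam_power :: "real \<Rightarrow> 'a::metric_space set \<Rightarrow> ennreal" where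
  "diam_power s U =
     (if U = {} then 0 else if s = 0 then 1 else ennreal (diameter U powr s))"

text \<open>
  Countable covers are sequences of sets; finite ones are padded with empty sets. Boundedness is
  demanded because \<^const>\<open>diameter\<close> is unspecified on unbounded sets.
\<close>

definition hausdorff_content :: "real \<Rightarrow> real \<Rightarrow> 'a::metric_space set \<Rightarrow> ennreal" where
  "hausdorff_content s \<epsilon> A =
     (INF U \<in> {U :: nat \<Rightarrow> 'a set. A \<subseteq> (\<Union>n. U n) \<and> (\<forall>n. bounded (U n) \<and> diameter (U n) < \<epsilon>)}.
        \<Sum>n. diam_power s (U n))"

definition hausdorff_outer :: "real \<Rightarrow> 'a::metric_space set \<Rightarrow> ennreal" where
  "hausdorff_outer s A = Lim (at_right 0) (\<lambda>\<epsilon>. hausdorff_content s \<epsilon> A)"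

text \<open>
  Since \<^const>\<open>measure_of\<close> yields the zero measure when the given set function is not countably
  additive, note \<open>emeasure_hausdorff_measure\<close> below.
\<close>

definition hausdorff_measure :: "real \<Rightarrow> 'a::metric_space measure" where
  "hausdorff_measure s = measure_of UNIV (sets borel) (hausdorff_outer s)"

text \<open>
  In a Euclidean space the infimum is over a nonempty set, as all \<open>s > DIM('a)\<close> belong to it.
\<close>

definition hausdorff_dim :: "'a::euclidean_space set \<Rightarrow> real" where
  "hausdorff_dim A = Inf {s. 0 \<le> s \<and> hausdorff_outer s A = 0}"

lemma hausdorff_content_antimono:
  assumes "\<epsilon> \<le> \<epsilon>'"
  shows "hausdorff_content s \<epsilon>' A \<le> hausdorff_content s \<epsilon> A"
  unfolding hausdorff_content_def using assms
  by (intro INF_superset_mono) (auto intro: less_le_trans)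

lemma tendsto_hausdorff_content:
  "((\<lambda>\<epsilon>. hausdorff_content s \<epsilon> A) \<longlongrightarrow> (SUP \<epsilon>\<in>{0<..}. hausdorff_content s \<epsilon> A)) (at_right 0)"
proof (rule order_tendstoI)
  fix y assume "y < (SUP \<epsilon>\<in>{0<..}. hausdorff_content s \<epsilon> A)"
  then obtain e where e: "e > 0" "y < hausdorff_content s e A"
    by (auto simp: less_SUP_iff)
  have "\<forall>\<^sub>F \<epsilon> in at_right 0. \<epsilon> \<in> {0<..<e}"
    using e by (intro eventually_at_right_real) auto
  then show "\<forall>\<^sub>F \<epsilon> in at_right 0. y < hausdorff_content s \<epsilon> A"
    by eventually_elim (rule less_le_trans[OF e(2) hausdorff_content_antimono], simp)
next
  fix y assume *: "(SUP \<epsilon>\<in>{0<..}. hausdorff_content s \<epsilon> A) < y"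
  have "\<forall>\<^sub>F \<epsilon> in at_right (0::real). \<epsilon> \<in> {0<..<1}"
    by (intro eventually_at_right_real) auto
  then show "\<forall>\<^sub>F \<epsilon> in at_right 0. hausdorff_content s \<epsilon> A < y"
    by eventually_elim (rule le_less_trans[OF SUP_upper *], simp)
qed

lemma hausdorff_outer_eq_SUP:
  "hausdorff_outer s A = (SUP \<epsilon>\<in>{0<..}. hausdorff_content s \<epsilon> A)"
  unfolding hausdorff_outer_def
  by (intro tendsto_Lim tendsto_hausdorff_content) auto

lemma hausdorff_content_le_outer:
  "\<epsilon> > 0 \<Longrightarrow> hausdorff_content s \<epsilon> A \<le> hausdorff_outer s A"
  unfolding hausdorff_outer_eq_SUP by (intro SUP_upper) auto

lemma diam_power_empty [simp]: "diam_power s {} = 0"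
  by (simp add: diam_power_def)

lemma hausdorff_outer_empty: "hausdorff_outer s {} = 0"
proof -
  have "hausdorff_content s \<epsilon> ({}::'a set) \<le> 0" if "\<epsilon> > 0" for \<epsilon>
    unfolding hausdorff_content_def
    by (rule INF_lower2[where i = "\<lambda>_. {}"]) (use that in auto)
  then show ?thesis
    unfolding hausdorff_outer_eq_SUP by (intro antisym SUP_least) auto
qed

lemma hausdorff_content_mono:
  "A \<subseteq> B \<Longrightarrow> hausdorff_content s \<epsilon> A \<le> hausdorff_content s \<epsilon> B"
  unfolding hausdorff_content_def by (intro INF_superset_mono) auto

lemma hausdorff_outer_mono:
  "A \<subseteq> B \<Longrightarrow> hausdorff_outer s A \<le> hausdorff_outer s B"
  unfolding hausdorff_outer_eq_SUP by (intro SUP_mono) (auto intro: hausdorff_content_mono)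

lemma hausdorff_content_subadd:
  fixes A :: "nat \<Rightarrow> 'a::metric_space set"
  shows "hausdorff_content s \<epsilon> (\<Union>i. A i) \<le> (\<Sum>i. hausdorff_content s \<epsilon> (A i))"
proof (rule ennreal_le_epsilon)
  fix e :: real assume fin: "(\<Sum>i. hausdorff_content s \<epsilon> (A i)) < top" and "e > 0"
  have "\<exists>U. A i \<subseteq> (\<Union>n. U n) \<and> (\<forall>n. bounded (U n) \<and> diameter (U n) < \<epsilon>) \<and>
      (\<Sum>n. diam_power s (U n)) < hausdorff_content s \<epsilon> (A i) + ennreal (e * (1/2) ^ Suc i)" for i
  proof -
    have "hausdorff_content s \<epsilon> (A i) < top"
      using fin by (metis ennreal_suminf_lessD)
    then have "hausdorff_content s \<epsilon> (A i) < hausdorff_content s \<epsilon> (A i) + ennreal (e * (1/2) ^ Suc i)"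
      using \<open>e > 0\<close> by (auto simp: ennreal_add_left_cancel_less less_top simp del: power_Suc)
    then show ?thesis
      unfolding hausdorff_content_def by (subst (asm) INF_less_iff) auto
  qed
  then obtain U where U: "\<And>i. A i \<subseteq> (\<Union>n. U i n)" "\<And>i n. bounded (U i n)"
      "\<And>i n. diameter (U i n) < \<epsilon>"
      "\<And>i. (\<Sum>n. diam_power s (U i n)) < hausdorff_content s \<epsilon> (A i) + ennreal (e * (1/2) ^ Suc i)"
    by metis
  define W where "W n = (case prod_decode n of (i, j) \<Rightarrow> U i j)" for n
  have cov: "(\<Union>i. A i) \<subseteq> (\<Union>n. W n)"
  proof clarify
    fix x i assume "x \<in> A i"
    then obtain j where "x \<in> U i j" using U(1) by blast
    then have "x \<in> W (prod_encode (i, j))" by (simp add: W_def)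
    then show "x \<in> (\<Union>n. W n)" by blast
  qed
  have "hausdorff_content s \<epsilon> (\<Union>i. A i) \<le> (\<Sum>n. diam_power s (W n))"
    unfolding hausdorff_content_def
    by (rule INF_lower) (use cov U in \<open>auto simp: W_def split: prod.split\<close>)
  also have "\<dots> = (\<Sum>i. \<Sum>j. diam_power s (U i j))"
    using suminf_ennreal_2dimen[of "\<lambda>i. \<Sum>j. diam_power s (U i j)" "\<lambda>(i, j). diam_power s (U i j)"]
    by (simp add: W_def case_prod_beta)
  also have "\<dots> \<le> (\<Sum>i. hausdorff_content s \<epsilon> (A i) + ennreal (e * (1/2) ^ Suc i))"
    using U(4) by (intro suminf_le) (auto intro: less_imp_le)
  also have "\<dots> = (\<Sum>i. hausdorff_content s \<epsilon> (A i)) + (\<Sum>i. ennreal (e * (1/2) ^ Suc i))"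
    by (subst suminf_add) auto
  also have "(\<Sum>i. ennreal (e * (1/2) ^ Suc i)) = ennreal e"
    using sums_mult[OF power_half_series, of e] \<open>e > 0\<close>
    by (subst suminf_ennreal_eq[where x = e]) auto
  finally show "hausdorff_content s \<epsilon> (\<Union>i. A i) \<le> (\<Sum>i. hausdorff_content s \<epsilon> (A i)) + ennreal e" .
qed

lemma hausdorff_outer_subadd:
  fixes A :: "nat \<Rightarrow> 'a::metric_space set"
  shows "hausdorff_outer s (\<Union>i. A i) \<le> (\<Sum>i. hausdorff_outer s (A i))"
proof -
  have "hausdorff_content s \<epsilon> (\<Union>i. A i) \<le> (\<Sum>i. hausdorff_outer s (A i))" if "\<epsilon> > 0" for \<epsilon>
    using hausdorff_content_subadd
    by (rule order_trans) (intro suminf_le hausdorff_content_le_outer that summableI)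
  then show ?thesis
    by (subst hausdorff_outer_eq_SUP) (auto intro: SUP_least)
qed

lemma hausdorff_outer_Un:
  fixes A B :: "'a::metric_space set"
  shows "hausdorff_outer s (A \<union> B) \<le> hausdorff_outer s A + hausdorff_outer s B"
proof -
  have "(\<Sum>i. hausdorff_outer s (binaryset A B i)) = hausdorff_outer s A + hausdorff_outer s B"
    by (rule suminf_binaryset_eq) (rule hausdorff_outer_empty)
  then show ?thesis
    using hausdorff_outer_subadd[of s "binaryset A B"] by (simp add: UN_binaryset_eq)
qed

lemma hausdorff_outer_separated:
  fixes A B :: "'a::metric_space set"
  assumes "e > 0" and sep: "\<And>x y. x \<in> A \<Longrightarrow> y \<in> B \<Longrightarrow> e \<le> dist x y"
  shows "hausdorff_outer s A + hausdorff_outer s B \<le> hausdorff_outer s (A \<union> B)"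
proof -
  have main: "hausdorff_content s \<epsilon> A + hausdorff_content s \<epsilon> B \<le> hausdorff_content s \<epsilon> (A \<union> B)"
    if "\<epsilon> > 0" "\<epsilon> \<le> e" for \<epsilon>
    unfolding hausdorff_content_def[of s \<epsilon> "A \<union> B"]
  proof (rule INF_greatest, clarify)
    fix U :: "nat \<Rightarrow> 'a set"
    assume cov: "A \<union> B \<subseteq> (\<Union>n. U n)" and U: "\<forall>n. bounded (U n) \<and> diameter (U n) < \<epsilon>"
    define UA where "UA n = (if U n \<inter> A = {} then {} else U n)" for n
    define UB where "UB n = (if U n \<inter> B = {} then {} else U n)" for n
    have "hausdorff_content s \<epsilon> A \<le> (\<Sum>n. diam_power s (UA n))"
      unfolding hausdorff_content_def
      by (rule INF_lower) (use cov U that in \<open>force simp: UA_def\<close>)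
    moreover have "hausdorff_content s \<epsilon> B \<le> (\<Sum>n. diam_power s (UB n))"
      unfolding hausdorff_content_def
      by (rule INF_lower) (use cov U that in \<open>force simp: UB_def\<close>)
    ultimately have "hausdorff_content s \<epsilon> A + hausdorff_content s \<epsilon> B
        \<le> (\<Sum>n. diam_power s (UA n)) + (\<Sum>n. diam_power s (UB n))"
      by (rule add_mono)
    also have "\<dots> = (\<Sum>n. diam_power s (UA n) + diam_power s (UB n))"
      by (subst suminf_add) auto
    also have "\<dots> \<le> (\<Sum>n. diam_power s (U n))"
    proof (intro suminf_le summableI)
      fix n
      have "U n \<inter> A = {} \<or> U n \<inter> B = {}"
      proof (rule ccontr)
        assume "\<not> ?thesis"
        then obtain x y where xy: "x \<in> U n" "x \<in> A" "y \<in> U n" "y \<in> B" by auto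
        then have "dist x y \<le> diameter (U n)"
          using U by (intro diameter_bounded_bound) auto
        then show False
          using sep[of x y] xy U that by (metis leD le_less_trans order_trans)
      qed
      then show "diam_power s (UA n) + diam_power s (UB n) \<le> diam_power s (U n)"
        by (auto simp: UA_def UB_def)
    qed
    finally show "hausdorff_content s \<epsilon> A + hausdorff_content s \<epsilon> B \<le> (\<Sum>n. diam_power s (U n))" .
  qed
  have lim: "((\<lambda>\<epsilon>. hausdorff_content s \<epsilon> C) \<longlongrightarrow> hausdorff_outer s C) (at_right 0)" for C :: "'a set"
    unfolding hausdorff_outer_eq_SUP by (rule tendsto_hausdorff_content)
  have "\<forall>\<^sub>F \<epsilon> in at_right 0. \<epsilon> \<in> {0<..<e}"
    using \<open>e > 0\<close> by (intro eventually_at_right_real) auto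
  then have "\<forall>\<^sub>F \<epsilon> in at_right 0.
      hausdorff_content s \<epsilon> A + hausdorff_content s \<epsilon> B \<le> hausdorff_content s \<epsilon> (A \<union> B)"
    by eventually_elim (auto intro: main)
  then show ?thesis
    by (intro tendsto_le[OF _ lim tendsto_add[OF lim lim]]) auto
qed

lemma hausdorff_outer_caratheodory_closed:
  fixes F A :: "'a::metric_space set"
  assumes "closed F"
  shows "hausdorff_outer s (A \<inter> F) + hausdorff_outer s (A - F) \<le> hausdorff_outer s A"
proof (cases "hausdorff_outer s A = top \<or> F = {}")
  case True
  then show ?thesis by (auto simp: hausdorff_outer_empty)
next
  case False
  let ?H = "hausdorff_outer s"
  have fin: "?H A < top" and "F \<noteq> {}" using False by (auto simp: less_top)
  define B where "B n = {x \<in> A. 1 / real (Suc n) \<le> infdist x F}" for n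
  define R where "R n = B (Suc n) - B n" for n
  have invmono: "1 / real (Suc n) \<le> 1 / real (Suc m)" if "m \<le> n" for m n
    using that by (intro divide_left_mono) auto
  have Bmono: "B m \<subseteq> B n" if "m \<le> n" for m n
    using invmono[OF that] by (auto simp: B_def)
  have BF: "?H (A \<inter> F) + ?H (B n) \<le> ?H A" for n
  proof -
    have "?H (A \<inter> F) + ?H (B n) \<le> ?H ((A \<inter> F) \<union> B n)"
    proof (rule hausdorff_outer_separated[of "1 / real (Suc n)"])
      fix x y assume "x \<in> A \<inter> F" "y \<in> B n"
      then show "1 / real (Suc n) \<le> dist x y"
        using infdist_le[of x F y] by (auto simp: B_def dist_commute)
    qed auto
    also have "\<dots> \<le> ?H A"
      by (rule hausdorff_outer_mono) (auto simp: B_def)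
    finally show ?thesis .
  qed
  have sepR: "?H (R n) + ?H (B m) \<le> ?H (R n \<union> B m)" if "m < n" for m n
  proof (rule hausdorff_outer_separated[of "1 / real (Suc m) - 1 / real (Suc n)"])
    show "0 < 1 / real (Suc m) - 1 / real (Suc n)"
      using that by (simp add: frac_less2)
    fix x y assume "x \<in> R n" "y \<in> B m"
    then have "infdist x F < 1 / real (Suc n)" "1 / real (Suc m) \<le> infdist y F"
      by (auto simp: R_def B_def)
    then show "1 / real (Suc m) - 1 / real (Suc n) \<le> dist x y"
      using infdist_triangle[of y F x] by (simp add: dist_commute)
  qed
  have sumR: "(\<Sum>k<n. ?H (R (2 * k + c + 1))) \<le> ?H (B (2 * n + c))" for n c
  proof (induction n)
    case (Suc n)
    have "(\<Sum>k<Suc n. ?H (R (2 * k + c + 1))) \<le> ?H (R (2 * n + c + 1)) + ?H (B (2 * n + c))"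
      using add_left_mono[OF Suc.IH] by (simp add: add.commute)
    also have "\<dots> \<le> ?H (R (2 * n + c + 1) \<union> B (2 * n + c))"
      by (rule sepR) simp
    also have "\<dots> \<le> ?H (B (2 * Suc n + c))"
      using Bmono[of "2 * n + c" "2 * Suc n + c"]
      by (intro hausdorff_outer_mono) (auto simp: R_def)
    finally show ?case .
  qed simp
  have HB: "?H (B n) \<le> ?H A" for n
    by (rule hausdorff_outer_mono) (auto simp: B_def)
  have sumR2: "(\<Sum>k<2 * n. ?H (R (Suc k))) \<le> ?H A + ?H A" for n
  proof -
    have "(\<Sum>k<2 * n. ?H (R (Suc k))) =
        (\<Sum>k<n. ?H (R (2 * k + 0 + 1))) + (\<Sum>k<n. ?H (R (2 * k + 1 + 1)))"
      by (induction n) (auto simp: ac_simps)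
    also have "\<dots> \<le> ?H A + ?H A"
      by (intro add_mono order_trans[OF sumR HB])
    finally show ?thesis .
  qed
  define f where "f k = ?H (R (Suc k))" for k
  have sumf: "(\<Sum>k<n. f k) \<le> ?H A + ?H A" for n
    using sumR2[of n] unfolding f_def
    by (rule order_trans[rotated]) (auto intro!: sum_mono2)
  have "(\<Sum>k. f k) \<le> ?H A + ?H A"
    using sumf by (intro suminf_le_const) auto
  then have finf: "(\<Sum>k. f k) < top"
    using fin by (auto intro: le_less_trans)
  have split: "(\<Sum>k. f k) - (\<Sum>k<n. f k) = (\<Sum>k. f (k + n))" for n
  proof -
    have "(\<Sum>k. f k) = (\<Sum>k. f (k + n)) + (\<Sum>k<n. f k)"
      by (rule suminf_offset) auto
    moreover have "(\<Sum>k<n. f k) < top"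
      by (rule le_less_trans[OF sumf]) (use fin in simp)
    ultimately show ?thesis by (simp only: ennreal_add_diff_cancel_right less_top)
  qed
  have "(\<lambda>n. (\<Sum>k. f k) - (\<Sum>k<n. f k)) \<longlonglongrightarrow> (\<Sum>k. f k) - (\<Sum>k. f k)"
    using finf by (intro tendsto_diff_ennreal tendsto_const summable_LIMSEQ) auto
  then have tail: "(\<lambda>n. \<Sum>k. f (k + n)) \<longlonglongrightarrow> 0"
    using finf by (simp add: split)
  have bound: "?H (A \<inter> F) + ?H (A - F) \<le> ?H A + (\<Sum>k. f (k + n))" for n
  proof -
    have "A - F \<subseteq> B (Suc n) \<union> (\<Union>k. R (Suc (k + n)))"
    proof
      fix x assume x: "x \<in> A - F"
      then have "infdist x F > 0"
        using \<open>closed F\<close> \<open>F \<noteq> {}\<close> in_closed_iff_infdist_zero infdist_pos_not_in_closed by fastforce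
      then obtain N where "1 / real (Suc N) < infdist x F"
        using nat_approx_posE by blast
      then have ex: "x \<in> B N" using x by (auto simp: B_def)
      define m where "m = (LEAST m. x \<in> B m)"
      have m: "x \<in> B m" unfolding m_def using ex by (rule LeastI)
      show "x \<in> B (Suc n) \<union> (\<Union>k. R (Suc (k + n)))"
      proof (cases "m \<le> Suc n")
        case True
        then show ?thesis using m Bmono by blast
      next
        case False
        then obtain k where k: "m = Suc (Suc (k + n))"
          by (metis add.commute add_Suc_right less_iff_Suc_add not_le)
        then have "x \<notin> B (Suc (k + n))"
          using not_less_Least[of "Suc (k + n)" "\<lambda>m. x \<in> B m"] by (simp add: m_def)
        then show ?thesis using m k by (auto simp: R_def)
      qed
    qed
    then have "?H (A - F) \<le> ?H (B (Suc n)) + ?H (\<Union>k. R (Suc (k + n)))"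
      using hausdorff_outer_mono hausdorff_outer_Un order_trans by blast
    also have "\<dots> \<le> ?H (B (Suc n)) + (\<Sum>k. f (k + n))"
      unfolding f_def by (intro add_left_mono hausdorff_outer_subadd)
    finally have "?H (A \<inter> F) + ?H (A - F) \<le> (?H (A \<inter> F) + ?H (B (Suc n))) + (\<Sum>k. f (k + n))"
      by (simp add: add.assoc add_left_mono)
    also have "\<dots> \<le> ?H A + (\<Sum>k. f (k + n))"
      by (intro add_right_mono BF)
    finally show ?thesis .
  qed
  have "(\<lambda>n. ?H A + (\<Sum>k. f (k + n))) \<longlonglongrightarrow> ?H A + 0"
    by (intro tendsto_add tendsto_const tail)
  then have "?H (A \<inter> F) + ?H (A - F) \<le> ?H A + 0"
    by (rule LIMSEQ_le_const) (use bound in auto)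
  then show ?thesis by simp
qed

lemma measure_space_hausdorff:
  "measure_space UNIV (sets borel) (hausdorff_outer s :: 'a::metric_space set \<Rightarrow> ennreal)"
proof -
  let ?H = "hausdorff_outer s :: 'a set \<Rightarrow> ennreal"
  let ?L = "lambda_system UNIV (Pow UNIV) ?H"
  interpret P: sigma_algebra "UNIV :: 'a set" "Pow UNIV" by (rule sigma_algebra_Pow)
  have outer: "outer_measure_space (Pow UNIV) ?H"
    unfolding outer_measure_space_def positive_def increasing_def countably_subadditive_def
    by (auto intro: hausdorff_outer_mono hausdorff_outer_subadd simp: hausdorff_outer_empty)
  have L: "measure_space UNIV ?L ?H"
    by (rule P.caratheodory_lemma[OF outer])
  then interpret L: sigma_algebra UNIV ?L by (simp add: measure_space_def)
  have "F \<in> ?L" if "closed F" for F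
  proof -
    have "?H (A \<inter> F) + ?H (A - F) = ?H A" for A
    proof (rule antisym)
      show "?H A \<le> ?H (A \<inter> F) + ?H (A - F)"
        using hausdorff_outer_Un[of s "A \<inter> F" "A - F"] by (simp add: Int_Diff_Un)
    qed (rule hausdorff_outer_caratheodory_closed[OF that])
    then show ?thesis using P.lambda_system_eq[of ?H] by auto
  qed
  then have "sets (borel :: 'a measure) \<subseteq> ?L"
    unfolding borel_eq_closed using L.sigma_sets_subset[of "Collect closed"] by auto
  moreover have "sigma_algebra UNIV (sets (borel :: 'a measure))"
    using sets.sigma_algebra_axioms[of "borel :: 'a measure"] by simp
  ultimately show ?thesis
    using L unfolding measure_space_def positive_def countably_additive_def
    by (meson order_trans subsetD)
qed

lemma space_hausdorff_measure [simp]: "space (hausdorff_measure s) = UNIV"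
  by (simp add: hausdorff_measure_def space_measure_of_conv)

lemma sets_hausdorff_measure [simp, measurable_cong]: "sets (hausdorff_measure s) = sets borel"
  using sets.sigma_sets_eq[of borel] by (simp add: hausdorff_measure_def sets_measure_of_conv)

lemma emeasure_hausdorff_measure:
  "A \<in> sets borel \<Longrightarrow> emeasure (hausdorff_measure s) A = hausdorff_outer s A"
  using measure_space_hausdorff[of s]
  by (intro emeasure_measure_of[OF hausdorff_measure_def]) (auto simp: measure_space_def)


section \<open>Regular Cantor sets\<close>

text \<open>
  \<open>C_class r V f\<close> says that \<open>f\<close> is of class \<open>C\<^sup>r\<close> on the open set \<open>V\<close>, for real \<open>r > 0\<close>: writing
  \<open>r = k + \<beta>\<close> with \<open>k\<close> a natural number and \<open>0 < \<beta> \<le> 1\<close>, \<open>f\<close> is \<open>k\<close> times differentiable and its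
  \<open>k\<close>-th derivative is \<open>\<beta>\<close>-Hoelder. In particular \<open>C\<^sup>1\<^sup>+\<^sup>\<alpha>\<close> with \<open>0 < \<alpha> \<le> 1\<close> means that the first
  derivative is \<open>\<alpha>\<close>-Hoelder. The Hoelder bound is uniform on \<open>V\<close>; below, \<open>V\<close> is an arbitrary
  neighbourhood of a compact set, which may be shrunk, so a locally uniform bound would amount to
  the same.
\<close>

definition C_class :: "real \<Rightarrow> real set \<Rightarrow> (real \<Rightarrow> real) \<Rightarrow> bool" where
  "C_class r V f \<longleftrightarrow>
     (let k = nat (\<lceil>r\<rceil> - 1); \<beta> = r - real k in
       (\<forall>j<k. \<forall>x\<in>V. (deriv ^^ j) f field_differentiable (at x)) \<and>
       (\<exists>C. \<forall>x\<in>V. \<forall>y\<in>V. \<bar>(deriv ^^ k) f x - (deriv ^^ k) f y\<bar> \<le> C * \<bar>x - y\<bar> powr \<beta>))"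

text \<open>
  The map \<open>\<psi>\<close> is a total function of which only the values on the neighbourhood \<open>V\<close> matter. The
  intersection over \<open>n\<close> includes \<open>n = 0\<close>, so every \<open>\<psi>\<^sup>n x\<close> with \<open>x \<in> K\<close> is computed inside \<open>V\<close>.
\<close>

definition regular_cantor_set :: "real \<Rightarrow> real set \<Rightarrow> bool" where
  "regular_cantor_set \<alpha> K \<longleftrightarrow>
     (\<exists>(r::nat) (I :: nat \<Rightarrow> real set) (\<psi> :: real \<Rightarrow> real) V.
        1 \<le> r \<and>
        (\<forall>i<r. \<exists>a b. a < b \<and> I i = {a..b} \<and> I i \<subseteq> {0..1}) \<and>
        disjoint_family_on I {..<r} \<and>
        K \<subseteq> (\<Union>i<r. I i) \<and>
        (\<forall>i<r. frontier (I i) \<subseteq> K) \<and>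
        open V \<and> (\<Union>i<r. I i) \<subseteq> V \<and>
        C_class (1 + \<alpha>) V \<psi> \<and>
        (\<forall>x\<in>V. 1 < \<bar>deriv \<psi> x\<bar>) \<and>
        (\<forall>i<r. \<exists>J\<subseteq>{..<r}. \<psi> ` I i = convex hull (\<Union>j\<in>J. I j)) \<and>
        (\<forall>i<r. \<forall>\<^sub>F n in sequentially. (\<psi> ^^ n) ` (K \<inter> I i) = K) \<and>
        K = (\<Inter>n. (\<psi> ^^ n) -` (\<Union>i<r. I i)))"


section \<open>Projections of the plane to lines\<close>

definition unit_dir :: "real \<Rightarrow> real \<times> real" where
  "unit_dir \<theta> = (cos \<theta>, sin \<theta>)"

definition line_dir :: "real \<Rightarrow> (real \<times> real) set" where
  "line_dir \<theta> = span {unit_dir \<theta>}"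

text \<open>The usual formula for the orthogonal projection, \<^term>\<open>unit_dir \<theta>\<close> being a unit vector.\<close>

definition proj_line :: "real \<Rightarrow> real \<times> real \<Rightarrow> real \<times> real" where
  "proj_line \<theta> x = (x \<bullet> unit_dir \<theta>) *\<^sub>R unit_dir \<theta>"

definition line_borel :: "real \<Rightarrow> (real \<times> real) measure" where
  "line_borel \<theta> = restrict_space borel (line_dir \<theta>)"

text \<open>Lebesgue measure on the line, transported by the isometry \<open>t \<mapsto> t v\<close>, where \<open>v\<close> is \<^term>\<open>unit_dir \<theta>\<close>.\<close>

definition line_lebesgue :: "real \<Rightarrow> (real \<times> real) measure" where
  "line_lebesgue \<theta> = distr lborel (line_borel \<theta>) (\<lambda>t. t *\<^sub>R unit_dir \<theta>)"

definition projected_measure :: "real \<Rightarrow> (real \<times> real) set \<Rightarrow> real \<Rightarrow> (real \<times> real) measure" where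
  "projected_measure d A \<theta> =
     distr (restrict_space (hausdorff_measure d) A) (line_borel \<theta>) (proj_line \<theta>)"

lemma proj_line_in: "proj_line \<theta> x \<in> line_dir \<theta>"
  by (simp add: proj_line_def line_dir_def span_base span_scale)

lemma inner_unit_dir: "unit_dir \<theta> \<bullet> unit_dir \<theta> = 1"
  by (simp add: unit_dir_def flip: power2_eq_square)

lemma proj_line_orthogonal: "y \<in> line_dir \<theta> \<Longrightarrow> orthogonal (x - proj_line \<theta> x) y"
  by (auto simp: line_dir_def span_singleton orthogonal_def proj_line_def inner_diff_left inner_unit_dir)

lemma emeasure_line_lebesgue:
  assumes "B \<in> sets (line_borel \<theta>)"
  shows "emeasure (line_lebesgue \<theta>) B = emeasure lborel {t. t *\<^sub>R unit_dir \<theta> \<in> B}"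
proof -
  have "(\<lambda>t. t *\<^sub>R unit_dir \<theta>) \<in> measurable lborel (line_borel \<theta>)"
    unfolding line_borel_def
    by (intro measurable_restrict_space2) (auto simp: line_dir_def span_base span_scale)
  then show ?thesis
    using assms by (simp add: line_lebesgue_def emeasure_distr vimage_def)
qed

lemma emeasure_projected_measure:
  assumes "A \<in> sets borel" "B \<in> sets (line_borel \<theta>)"
  shows "emeasure (projected_measure d A \<theta>) B = hausdorff_outer d (A \<inter> proj_line \<theta> -` B)"
proof -
  have m: "proj_line \<theta> \<in> measurable borel (line_borel \<theta>)"
    unfolding line_borel_def
    by (intro measurable_restrict_space2) (simp add: proj_line_in, simp add: proj_line_def[abs_def])
  then have m': "proj_line \<theta> \<in> measurable (restrict_space (hausdorff_measure d) A) (line_borel \<theta>)"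
    by (intro measurable_restrict_space1) (simp cong: measurable_cong_sets)
  have "A \<inter> proj_line \<theta> -` B \<in> sets borel"
    using assms measurable_sets[OF m assms(2)] by (auto intro!: sets.Int)
  then show ?thesis
    using assms m'
    by (simp add: projected_measure_def emeasure_distr space_restrict_space emeasure_restrict_space
        emeasure_hausdorff_measure Int_commute)
qed

end

theory Submission
  imports Defs
begin

text \<open>
  Marstrand's argument. Let \<open>\<nu>\<close> be the restriction of \<open>m\<^sub>d\<close> to \<open>K\<^sub>1 \<times> K\<^sub>2\<close>. If \<open>\<nu> (cball z R) \<le> C R\<^sup>d\<close> with
  \<open>d > 1\<close>, then the energy of \<open>\<nu>\<close> for the kernel \<open>1 / |x - y|\<close> is finite; since the directions in which
  \<open>x - y\<close> projects to length at most \<open>r\<close> form a set of measure \<open>O(r / |x - y|)\<close>, Fatou's lemma bounds the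
  \<open>L\<^sup>2\<close>-norms of the mollified projections for almost every \<open>\<theta>\<close>.

  The bound on \<open>\<nu>\<close> follows from an estimate of the number of \<open>\<rho>\<close>-separated points of \<open>K\<^sub>i\<close> in a set of
  diameter \<open>R\<close> by \<open>C (R / \<rho>)\<^sup>s\<close>, where \<open>s = HD(K\<^sub>i)\<close>. No invariant measure is needed for it: by bounded
  distortion, every ball of radius \<open>r\<close> centred in \<open>K\<close> contains a copy of \<open>K\<close> shrunk by a factor that is
  at least a constant times \<open>r\<close>, so too many separated points would produce a subset of dimension greater than \<open>s\<close>; and every
  small piece of \<open>K\<close> can be blown up to unit size by an iterate of the expanding map.
\<close>

text \<open>The measure is prescribed: Frostman's lemma would produce some measure with good ball
  growth, but here \<open>hausdorff_measure d\<close> itself must have it, on a product. A Hausdorff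
  cover of one factor mixes all scales and does not multiply with a cover of the other, so both
  factors are counted at one common scale \<rho>. The exponent of the count has to be exactly s =
  \<open>hausdorff_dim K\<close>: squares of side about \<rho> cost about \<rho>^d each and \<rho>
  tends to 0, so any loss in the exponent would make the bound on m_d diverge. This is why the count
  is proved by contradiction: any excess over the bound yields a similarity dimension strictly above
  s, hence nonzero measure in some dimension t > s, against the definition of s as an infimum. The
  kernel has exponent 1 because the image is a line; dyadic balls around a point contribute a
  geometric series of ratio 2^(1 - d) to the energy.\<close>

section \<open>Absolute continuity of almost every projection\<close>

text \<open>The averaged densities \<open>f n\<close> are bounded in \<open>L\<^sup>2\<close> along a subsequence. The pointwise inequality
  \<open>f \<le> k + f\<^sup>2 / k\<close> then replaces Cauchy-Schwarz in the estimate of the measure of an open set.\<close>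

lemma absolutely_continuous_of_liminf_energy:
  fixes \<mu> :: "real measure" and r :: "nat \<Rightarrow> real"
  assumes "finite_measure \<mu>" and [measurable_cong, simp]: "sets \<mu> = sets borel"
    and r: "\<And>n. r n > 0" "r \<longlonglongrightarrow> 0"
    and fin: "liminf (\<lambda>n. emeasure (\<mu> \<Otimes>\<^sub>M \<mu>) {z. \<bar>fst z - snd z\<bar> \<le> 2 * r n} / ennreal (r n)) < top"
  shows "absolutely_continuous lborel \<mu>"
proof -
  interpret finite_measure \<mu> by fact
  interpret P: pair_sigma_finite lborel \<mu>
    by (simp add: pair_sigma_finite_def sigma_finite_lborel sigma_finite_measure_axioms)
  interpret PP: pair_sigma_finite \<mu> \<mu>
    by (simp add: pair_sigma_finite_def sigma_finite_measure_axioms)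
  have [simp]: "space \<mu> = UNIV" using sets_eq_imp_space_eq[of \<mu> borel] by simp
  define Q where "Q n = emeasure (\<mu> \<Otimes>\<^sub>M \<mu>) {z. \<bar>fst z - snd z\<bar> \<le> 2 * r n} / ennreal (r n)" for n
  define f where "f n u = emeasure \<mu> (cball u (r n)) / ennreal (2 * r n)" for n and u :: real
  have SP[measurable]: "{z. \<bar>fst z - snd z\<bar> \<le> \<rho>} \<in> sets (\<mu> \<Otimes>\<^sub>M \<mu>)" for \<rho>
  proof -
    have "Measurable.pred (borel \<Otimes>\<^sub>M borel) (\<lambda>z::real\<times>real. \<bar>fst z - snd z\<bar> \<le> \<rho>)"
      by measurable
    then show ?thesis
      by (simp add: pred_def space_pair_measure cong: sets_pair_measure_cong)
  qed
  have [measurable]: "(\<lambda>u. emeasure \<mu> (cball u \<rho>)) \<in> borel_measurable borel" for \<rho>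
  proof -
    have "Measurable.pred (borel \<Otimes>\<^sub>M borel) (\<lambda>z::real\<times>real. dist (fst z) (snd z) \<le> \<rho>)"
      by measurable
    then have "{z::real\<times>real. dist (fst z) (snd z) \<le> \<rho>} \<in> sets (borel \<Otimes>\<^sub>M \<mu>)"
      by (simp add: pred_def space_pair_measure cong: sets_pair_measure_cong)
    from measurable_emeasure_Pair[OF this] show ?thesis
      by (simp add: cball_def vimage_def)
  qed
  have [measurable]: "f n \<in> borel_measurable borel" for n unfolding f_def by measurable
  \<comment> \<open>The square of the mass of a ball is the product measure of the pairs with both
    points within \<open>r n\<close> of u. Such u fill a set of length at most
    \<open>2 * r n\<close>, and there are none unless the two points are within
    \<open>2 * r n\<close> of each other; Tonelli then leaves only pairs close to the
    diagonal.\<close>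
  have L2: "(\<integral>\<^sup>+u. f n u * f n u \<partial>lborel) \<le> Q n" for n
  proof -
    have "(\<integral>\<^sup>+u. emeasure \<mu> (cball u (r n)) * emeasure \<mu> (cball u (r n)) \<partial>lborel)
      = (\<integral>\<^sup>+u. (\<integral>\<^sup>+z. indicator {z. dist u (fst z) \<le> r n \<and> dist u (snd z) \<le> r n} z \<partial>(\<mu> \<Otimes>\<^sub>M \<mu>)) \<partial>lborel)"
    proof (rule nn_integral_cong)
      fix u :: real
      have "{z. dist u (fst z) \<le> r n \<and> dist u (snd z) \<le> r n} = cball u (r n) \<times> cball u (r n)"
        by auto
      then show "emeasure \<mu> (cball u (r n)) * emeasure \<mu> (cball u (r n)) =
         (\<integral>\<^sup>+z. indicator {z. dist u (fst z) \<le> r n \<and> dist u (snd z) \<le> r n} z \<partial>(\<mu> \<Otimes>\<^sub>M \<mu>))"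
        by (simp add: emeasure_pair_measure_Times)
    qed
    also have "\<dots> = (\<integral>\<^sup>+z. (\<integral>\<^sup>+u. indicator {z. dist u (fst z) \<le> r n \<and> dist u (snd z) \<le> r n} z \<partial>lborel) \<partial>(\<mu> \<Otimes>\<^sub>M \<mu>))"
    proof -
      interpret X: pair_sigma_finite lborel "\<mu> \<Otimes>\<^sub>M \<mu>"
        by (simp add: pair_sigma_finite_def sigma_finite_lborel PP.sigma_finite_measure_axioms)
      show ?thesis
        by (rule X.Fubini'[symmetric]) measurable
    qed
    also have "\<dots> \<le> (\<integral>\<^sup>+z. ennreal (2 * r n) * indicator {z. \<bar>fst z - snd z\<bar> \<le> 2 * r n} z \<partial>(\<mu> \<Otimes>\<^sub>M \<mu>))"
    proof (rule nn_integral_mono)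
      fix z :: "real \<times> real"
      have "(\<integral>\<^sup>+u. indicator {z. dist u (fst z) \<le> r n \<and> dist u (snd z) \<le> r n} z \<partial>lborel)
         = (\<integral>\<^sup>+u. indicator {u. dist u (fst z) \<le> r n \<and> dist u (snd z) \<le> r n} u \<partial>lborel)"
        by (intro nn_integral_cong) (simp add: indicator_def)
      also have "\<dots> = emeasure lborel {u. dist u (fst z) \<le> r n \<and> dist u (snd z) \<le> r n}"
        by (intro nn_integral_indicator) measurable
      also have "\<dots> \<le> ennreal (2 * r n) * indicator {z. \<bar>fst z - snd z\<bar> \<le> 2 * r n} z"
      proof (cases "\<bar>fst z - snd z\<bar> \<le> 2 * r n")
        case True
        have "emeasure lborel {u. dist u (fst z) \<le> r n \<and> dist u (snd z) \<le> r n}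
          \<le> emeasure lborel {fst z - r n..fst z + r n}"
          by (intro emeasure_mono) (auto simp: dist_real_def)
        then show ?thesis using True r(1)[of n] by simp
      next
        case False
        then have "\<not> (dist u (fst z) \<le> r n \<and> dist u (snd z) \<le> r n)" for u
          unfolding dist_real_def by linarith
        then have "{u. dist u (fst z) \<le> r n \<and> dist u (snd z) \<le> r n} = {}" by blast
        then show ?thesis by (simp only: emeasure_empty zero_le)
      qed
      finally show "(\<integral>\<^sup>+u. indicator {z. dist u (fst z) \<le> r n \<and> dist u (snd z) \<le> r n} z \<partial>lborel)
        \<le> ennreal (2 * r n) * indicator {z. \<bar>fst z - snd z\<bar> \<le> 2 * r n} z" .
    qed
    also have "\<dots> = ennreal (2 * r n) * emeasure (\<mu> \<Otimes>\<^sub>M \<mu>) {z. \<bar>fst z - snd z\<bar> \<le> 2 * r n}"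
      using SP[of "2 * r n"] by (subst nn_integral_cmult) auto
    finally have *: "(\<integral>\<^sup>+u. emeasure \<mu> (cball u (r n)) * emeasure \<mu> (cball u (r n)) \<partial>lborel)
      \<le> ennreal (2 * r n) * emeasure (\<mu> \<Otimes>\<^sub>M \<mu>) {z. \<bar>fst z - snd z\<bar> \<le> 2 * r n}" .
    define c where "c = ennreal (2 * r n)"
    \<comment> \<open>Two normalising factors 1 / (2 r) meet one length 2 r; the remaining 1 / (2 r)
      is relaxed to 1 / r.\<close>
    have c: "inverse c * c = 1" "inverse c \<le> inverse (ennreal (r n))"
      using r(1)[of n] by (auto simp: c_def inverse_ennreal ennreal_mult'[symmetric] intro!: ennreal_leI)
    have "(\<integral>\<^sup>+u. f n u * f n u \<partial>lborel)
      = (\<integral>\<^sup>+u. (inverse c * inverse c) * (emeasure \<mu> (cball u (r n)) * emeasure \<mu> (cball u (r n))) \<partial>lborel)"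
      by (simp only: f_def c_def divide_ennreal_def ac_simps)
    also have "\<dots> = (inverse c * inverse c) * (\<integral>\<^sup>+u. emeasure \<mu> (cball u (r n)) * emeasure \<mu> (cball u (r n)) \<partial>lborel)"
      by (rule nn_integral_cmult) measurable
    also have "\<dots> \<le> (inverse c * inverse c) * (c * emeasure (\<mu> \<Otimes>\<^sub>M \<mu>) {z. \<bar>fst z - snd z\<bar> \<le> 2 * r n})"
      unfolding c_def by (intro mult_left_mono *) auto
    also have "\<dots> = inverse c * (inverse c * c) * emeasure (\<mu> \<Otimes>\<^sub>M \<mu>) {z. \<bar>fst z - snd z\<bar> \<le> 2 * r n}"
      by (simp only: ac_simps)
    also have "\<dots> \<le> inverse (ennreal (r n)) * emeasure (\<mu> \<Otimes>\<^sub>M \<mu>) {z. \<bar>fst z - snd z\<bar> \<le> 2 * r n}"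
      using c(2) by (simp add: c(1) mult_right_mono)
    also have "\<dots> = Q n"
      by (simp add: Q_def divide_ennreal_def mult.commute)
    finally show ?thesis .
  qed
  define q where "q = liminf Q"
  have "q < top" using fin unfolding q_def Q_def .
  \<comment> \<open>Openness makes the normalised length of \<open>U \<inter> cball v (r n)\<close>
    equal to 1 for v in U and large n. Fatou therefore bounds the mass of U by mollified masses, and
    Tonelli turns these into integrals of \<open>f n\<close> over U.\<close>
  have open_bound: "emeasure \<mu> U \<le> ennreal k * emeasure lborel U + q / ennreal k"
    if "open U" "k > 0" for U k
  proof -
    have [measurable]: "U \<in> sets borel" using that by auto
    have "emeasure \<mu> U = (\<integral>\<^sup>+v. indicator U v \<partial>\<mu>)" by simp
    also have "\<dots> \<le> (\<integral>\<^sup>+v. liminf (\<lambda>n. emeasure lborel (U \<inter> cball v (r n)) / ennreal (2 * r n)) \<partial>\<mu>)"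
    proof (rule nn_integral_mono)
      fix v
      show "indicator U v \<le> liminf (\<lambda>n. emeasure lborel (U \<inter> cball v (r n)) / ennreal (2 * r n))"
      proof (cases "v \<in> U")
        case True
        then obtain e where e: "e > 0" "cball v e \<subseteq> U"
          using \<open>open U\<close> open_contains_cball by blast
        have "\<forall>\<^sub>F n in sequentially. r n < e"
          using order_tendstoD(2)[OF r(2) e(1)] .
        then have "\<forall>\<^sub>F n in sequentially. 1 \<le> emeasure lborel (U \<inter> cball v (r n)) / ennreal (2 * r n)"
        proof eventually_elim
          case (elim n)
          have "U \<inter> cball v (r n) = {v - r n .. v + r n}"
            using e elim by (auto simp: cball_eq_atLeastAtMost)
          then show ?case using r(1)[of n]
            by (simp add: divide_ennreal)
        qed
        then show ?thesis using True
          by (simp add: Liminf_bounded)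
      qed simp
    qed
    also have "\<dots> \<le> liminf (\<lambda>n. \<integral>\<^sup>+v. emeasure lborel (U \<inter> cball v (r n)) / ennreal (2 * r n) \<partial>\<mu>)"
    proof (rule nn_integral_liminf)
      fix n
      have "Measurable.pred (borel \<Otimes>\<^sub>M borel) (\<lambda>z::real\<times>real. snd z \<in> U \<and> dist (fst z) (snd z) \<le> r n)"
        by measurable
      then have "{z::real\<times>real. snd z \<in> U \<and> dist (fst z) (snd z) \<le> r n} \<in> sets (\<mu> \<Otimes>\<^sub>M lborel)"
        by (simp add: pred_def space_pair_measure cong: sets_pair_measure_cong)
      from lborel.measurable_emeasure_Pair[OF this]
      have "(\<lambda>v. emeasure lborel (U \<inter> cball v (r n))) \<in> borel_measurable \<mu>"
        by (simp add: vimage_def Int_def cball_def)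
      then show "(\<lambda>v. emeasure lborel (U \<inter> cball v (r n)) / ennreal (2 * r n)) \<in> borel_measurable \<mu>"
        by measurable
    qed
    also have "(\<lambda>n. \<integral>\<^sup>+v. emeasure lborel (U \<inter> cball v (r n)) / ennreal (2 * r n) \<partial>\<mu>)
       = (\<lambda>n. \<integral>\<^sup>+u. f n u * indicator U u \<partial>lborel)"
    proof
      fix n
      have "(\<integral>\<^sup>+v. emeasure lborel (U \<inter> cball v (r n)) / ennreal (2 * r n) \<partial>\<mu>)
        = (\<integral>\<^sup>+v. (\<integral>\<^sup>+u. indicator {z. fst z \<in> U \<and> dist (fst z) (snd z) \<le> r n} (u, v) / ennreal (2 * r n) \<partial>lborel) \<partial>\<mu>)"
      proof (rule nn_integral_cong)
        fix v
        have "(\<integral>\<^sup>+u. indicator {z. fst z \<in> U \<and> dist (fst z) (snd z) \<le> r n} (u, v) / ennreal (2 * r n) \<partial>lborel)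
          = (\<integral>\<^sup>+u. indicator (U \<inter> cball v (r n)) u / ennreal (2 * r n) \<partial>lborel)"
          by (intro nn_integral_cong) (auto simp: indicator_def dist_commute)
        also have "\<dots> = emeasure lborel (U \<inter> cball v (r n)) / ennreal (2 * r n)"
        proof -
          have "U \<inter> cball v (r n) \<in> sets lborel" by simp
          then show ?thesis by (subst nn_integral_divide) (auto intro: borel_measurable_indicator)
        qed
        finally show "emeasure lborel (U \<inter> cball v (r n)) / ennreal (2 * r n) =
          (\<integral>\<^sup>+u. indicator {z. fst z \<in> U \<and> dist (fst z) (snd z) \<le> r n} (u, v) / ennreal (2 * r n) \<partial>lborel)" ..
      qed
      also have "\<dots> = (\<integral>\<^sup>+u. (\<integral>\<^sup>+v. indicator {z. fst z \<in> U \<and> dist (fst z) (snd z) \<le> r n} (u, v) / ennreal (2 * r n) \<partial>\<mu>) \<partial>lborel)"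
        by (rule P.Fubini') measurable
      also have "\<dots> = (\<integral>\<^sup>+u. f n u * indicator U u \<partial>lborel)"
      proof (rule nn_integral_cong)
        fix u
        have "(\<integral>\<^sup>+v. indicator {z. fst z \<in> U \<and> dist (fst z) (snd z) \<le> r n} (u, v) / ennreal (2 * r n) \<partial>\<mu>)
          = (\<integral>\<^sup>+v. indicator U u * (indicator (cball u (r n)) v / ennreal (2 * r n)) \<partial>\<mu>)"
          by (intro nn_integral_cong) (auto simp: indicator_def)
        also have "\<dots> = indicator U u * (emeasure \<mu> (cball u (r n)) / ennreal (2 * r n))"
        proof -
          have [measurable]: "indicator (cball u (r n)) \<in> borel_measurable \<mu>"
            by (rule borel_measurable_indicator) simp
          have "(\<integral>\<^sup>+v. indicator (cball u (r n)) v / ennreal (2 * r n) \<partial>\<mu>)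
              = emeasure \<mu> (cball u (r n)) / ennreal (2 * r n)"
            by (subst nn_integral_divide) auto
          then show ?thesis
            by (subst nn_integral_cmult) auto
        qed
        finally show "(\<integral>\<^sup>+v. indicator {z. fst z \<in> U \<and> dist (fst z) (snd z) \<le> r n} (u, v) / ennreal (2 * r n) \<partial>\<mu>) = f n u * indicator U u"
          by (simp add: f_def mult.commute)
      qed
      finally show "(\<integral>\<^sup>+v. emeasure lborel (U \<inter> cball v (r n)) / ennreal (2 * r n) \<partial>\<mu>)
         = (\<integral>\<^sup>+u. f n u * indicator U u \<partial>lborel)" .
    qed
    also have "liminf (\<lambda>n. \<integral>\<^sup>+u. f n u * indicator U u \<partial>lborel)
       \<le> liminf (\<lambda>n. ennreal k * emeasure lborel U + Q n / ennreal k)"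
    proof (rule Liminf_mono, rule always_eventually, rule allI)
      fix n
      have "(\<integral>\<^sup>+u. f n u * indicator U u \<partial>lborel)
         \<le> (\<integral>\<^sup>+u. ennreal k * indicator U u + f n u * f n u / ennreal k \<partial>lborel)"
      proof (rule nn_integral_mono)
        fix u
        have "f n u < top"
          using r(1)[of n] by (simp add: f_def ennreal_divide_eq_top_iff less_top[symmetric])
        then obtain a where a: "f n u = ennreal a" "a \<ge> 0" by (cases "f n u") auto
        have "a \<le> k + a * a / k"
        proof (cases "a \<le> k")
          case False
          then have "a * k \<le> a * a" using a by (intro mult_left_mono) auto
          then have "a \<le> a * a / k" using \<open>k > 0\<close> by (simp add: field_simps)
          then show ?thesis using \<open>k > 0\<close> by linarith
        qed (use \<open>k > 0\<close> a in \<open>simp add: add_increasing2\<close>)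
        then have "f n u \<le> ennreal k + f n u * f n u / ennreal k"
          using a \<open>k > 0\<close> by (simp add: divide_ennreal ennreal_leI flip: ennreal_mult' ennreal_plus)
        then show "f n u * indicator U u \<le> ennreal k * indicator U u + f n u * f n u / ennreal k"
          by (auto simp: indicator_def)
      qed
      also have "\<dots> = ennreal k * emeasure lborel U + (\<integral>\<^sup>+u. f n u * f n u \<partial>lborel) / ennreal k"
        by (subst nn_integral_add) (auto simp: nn_integral_cmult nn_integral_divide)
      also have "\<dots> \<le> ennreal k * emeasure lborel U + Q n / ennreal k"
        by (intro add_left_mono divide_right_mono_ennreal L2)
      finally show "(\<integral>\<^sup>+u. f n u * indicator U u \<partial>lborel) \<le> ennreal k * emeasure lborel U + Q n / ennreal k" .
    qed
    also have "\<dots> = ennreal k * emeasure lborel U + q / ennreal k"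
    proof -
      have "ennreal k \<noteq> 0" using \<open>k > 0\<close> by simp
      have "continuous_on UNIV (\<lambda>x. ennreal k * emeasure lborel U + inverse (ennreal k) * x)"
        using \<open>k > 0\<close>
        by (intro continuous_on_add_ennreal continuous_on_const ennreal_continuous_on_cmult continuous_on_id)
           (simp add: inverse_ennreal)
      moreover have "mono (\<lambda>x. ennreal k * emeasure lborel U + inverse (ennreal k) * x)"
        by (intro monoI add_left_mono mult_left_mono) auto
      ultimately have "liminf (\<lambda>n. ennreal k * emeasure lborel U + inverse (ennreal k) * Q n) =
          ennreal k * emeasure lborel U + inverse (ennreal k) * liminf Q"
        by (rule Liminf_compose_continuous_mono) simp
      then show ?thesis by (simp add: q_def divide_ennreal_def mult.commute)
    qed
    finally show ?thesis .
  qed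
  show ?thesis
    unfolding absolutely_continuous_def
  proof
    fix N assume N: "N \<in> null_sets (lborel :: real measure)"
    then have Nb: "N \<in> sets borel" "emeasure lborel N = 0" by auto
    have "emeasure \<mu> N \<le> 0 + ennreal e" if "e > 0" for e
    proof -
      obtain q' where q': "q = ennreal q'" "q' \<ge> 0" using \<open>q < top\<close> by (cases q) auto
      \<comment> \<open>Large enough to make the energy term at most e / 2; the \<open>+ 1\<close>
        keeps k positive when q' = 0. The tolerance e / (2 k) in the choice of U then makes the
        other term at most e / 2.\<close>
      define k where "k = (q' + 1) * 2 / e"
      have k: "k > 0" using q' that by (simp add: k_def)
      have "q' / k \<le> e / 2" using q' that by (simp add: k_def field_simps)
      then have qk: "q / ennreal k \<le> ennreal (e / 2)"
        using q' k by (simp add: divide_ennreal ennreal_leI)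
      have "0 < e / (2 * k)" using that k by simp
      from outer_regular_lborel[OF Nb(1) this]
      obtain U where U: "open U" "N \<subseteq> U" "emeasure lborel (U - N) \<le> ennreal (e / (2 * k))" by (metis less_imp_le)
      have "emeasure lborel U = emeasure lborel (U - N)"
        using N U(1) by (subst emeasure_Diff_null_set) auto
      then have "ennreal k * emeasure lborel U \<le> ennreal k * ennreal (e / (2 * k))"
        using U(3) by (simp add: mult_left_mono)
      also have "\<dots> = ennreal (e / 2)" using k by (simp flip: ennreal_mult')
      finally have *: "ennreal k * emeasure lborel U \<le> ennreal (e / 2)" .
      have "emeasure \<mu> N \<le> emeasure \<mu> U" using U by (intro emeasure_mono) auto
      also have "\<dots> \<le> ennreal k * emeasure lborel U + q / ennreal k" by (rule open_bound[OF U(1) k])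
      also have "\<dots> \<le> ennreal (e / 2) + ennreal (e / 2)" by (intro add_mono * qk)
      also have "\<dots> = ennreal e" using that by (simp flip: ennreal_plus)
      finally show ?thesis by simp
    qed
    then have "emeasure \<mu> N \<le> 0" by (rule ennreal_le_epsilon)
    then show "N \<in> null_sets \<mu>" using Nb by (auto simp: null_sets_def)
  qed
qed

text \<open>A dyadic majorant of the Riesz kernel \<open>1 / t\<close>. It is infinite at \<open>0\<close>, so that the diagonal needs
  no separate treatment.\<close>

definition riesz_dom :: "real \<Rightarrow> ennreal" where
  "riesz_dom t = 1 + (\<Sum>k. 2 ^ Suc k * indicator {..1 / 2 ^ k} t)"

text \<open>For s \<le> 1 choose k with 2^k \<le> 1 / s < 2^(k + 1): then t \<le> s \<le> 2^(-k), so
  the summand k is switched on and alone exceeds 1 / s. Keeping t apart from s makes the bound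
  usable at t = 0, with any s.\<close>

lemma inverse_le_riesz_dom:
  assumes "t \<le> s" "0 < s"
  shows "ennreal (1 / s) \<le> riesz_dom t"
proof (cases "s > 1")
  case True
  then have "ennreal (1 / s) \<le> 1" by simp
  then show ?thesis unfolding riesz_dom_def by (rule order_trans) simp
next
  case False
  define n where "n = (LEAST n::nat. 1 / s < 2 ^ n)"
  have "\<exists>n. 1 / s < 2 ^ n" by (rule real_arch_pow) simp
  then have n: "1 / s < 2 ^ n" unfolding n_def by (rule LeastI_ex)
  have "n \<noteq> 0" using n False assms by (intro notI) (simp add: field_simps)
  then obtain k where k: "n = Suc k" by (cases n) auto
  then have "\<not> 1 / s < 2 ^ k" using not_less_Least[of k "\<lambda>n. 1 / s < 2 ^ n"] by (simp add: n_def)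
  then have "s \<le> 1 / 2 ^ k" using assms by (simp add: field_simps)
  then have "t \<le> 1 / 2 ^ k" using assms by linarith
  have "ennreal (1 / s) \<le> ennreal (2 ^ Suc k)" using n k by (intro ennreal_leI) simp
  also have "\<dots> = (\<Sum>i\<in>{k}. 2 ^ Suc i * indicator {..1 / 2 ^ i} t)"
    using \<open>t \<le> 1 / 2 ^ k\<close> by (simp add: indicator_def ennreal_power[symmetric] ennreal_mult'')
  also have "\<dots> \<le> (\<Sum>i. 2 ^ Suc i * indicator {..1 / 2 ^ i} t)"
    by (rule sum_le_suminf) auto
  also have "\<dots> \<le> riesz_dom t" unfolding riesz_dom_def by simp
  finally show ?thesis .
qed

lemma measurable_riesz_dom [measurable]: "riesz_dom \<in> borel_measurable borel"
  unfolding riesz_dom_def by measurable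

text \<open>The ball of radius 2^(-k) contributes at most 2^(k + 1) * C * 2^(-k d), a geometric
  series of ratio 2^(1 - d) < 1. As the bound does not depend on x, it can be integrated once more
  to bound the energy.\<close>

lemma nn_integral_riesz_dom:
  fixes \<nu> :: "'a::{metric_space,second_countable_topology} measure"
  assumes "finite_measure \<nu>" and [measurable_cong, simp]: "sets \<nu> = sets borel"
    and C: "C \<ge> 0" "d > 1"
    and frost: "\<And>z R. 0 < R \<Longrightarrow> R \<le> 1 \<Longrightarrow> emeasure \<nu> (cball z R) \<le> ennreal (C * R powr d)"
  obtains B :: real where "\<And>x. (\<integral>\<^sup>+y. riesz_dom (dist x y) \<partial>\<nu>) \<le> ennreal B"
proof -
  interpret finite_measure \<nu> by fact
  have [simp]: "space \<nu> = UNIV" using sets_eq_imp_space_eq[of \<nu> borel] by simp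
  define q where "q = 2 powr (1 - d)"
  have q: "0 < q" "q < 1" using C by (auto simp: q_def powr_less_one)
  define B where "B = measure \<nu> UNIV + 2 * C / (1 - q)"
  have "(\<integral>\<^sup>+y. riesz_dom (dist x y) \<partial>\<nu>) \<le> ennreal B" for x
  proof -
    have [measurable]: "indicator (cball x \<rho>) \<in> borel_measurable \<nu>" for \<rho>
      by (rule borel_measurable_indicator) simp
    have "(\<integral>\<^sup>+y. riesz_dom (dist x y) \<partial>\<nu>)
      = (\<integral>\<^sup>+y. 1 + (\<Sum>k. 2 ^ Suc k * indicator (cball x (1 / 2 ^ k)) y) \<partial>\<nu>)"
      unfolding riesz_dom_def by (intro nn_integral_cong) (auto simp: indicator_def cong: if_cong)
    also have "\<dots> = emeasure \<nu> UNIV + (\<integral>\<^sup>+y. (\<Sum>k. 2 ^ Suc k * indicator (cball x (1 / 2 ^ k)) y) \<partial>\<nu>)"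
      by (subst nn_integral_add) auto
    also have "(\<integral>\<^sup>+y. (\<Sum>k. 2 ^ Suc k * indicator (cball x (1 / 2 ^ k)) y) \<partial>\<nu>)
       = (\<Sum>k. 2 ^ Suc k * emeasure \<nu> (cball x (1 / 2 ^ k)))"
      by (subst nn_integral_suminf) (auto simp: nn_integral_cmult)
    also have "\<dots> \<le> (\<Sum>k. ennreal (2 * C * q ^ k))"
    proof (intro suminf_le summableI)
      fix k
      have e: "2 ^ Suc k * (C * (1 / 2 ^ k) powr d) = 2 * C * q ^ k"
      proof -
        have "(1 / 2 ^ k) powr d = 2 powr (- d * real k)"
        proof -
          have "1 / 2 ^ k = (2::real) powr (- real k)"
            by (simp add: powr_minus powr_realpow divide_inverse)
          then show ?thesis by (simp add: powr_powr mult.commute)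
        qed
        moreover have "q ^ k = 2 powr ((1 - d) * real k)"
          using q by (simp add: q_def powr_powr flip: powr_realpow)
        moreover have "(2::real) ^ k = 2 powr (real k)" by (simp add: powr_realpow)
        moreover have "(2::real) powr (real k) * 2 powr (- d * real k) = 2 powr ((1 - d) * real k)"
          by (simp add: left_diff_distrib flip: powr_add)
        ultimately show ?thesis by (metis (no_types, lifting) mult.assoc mult.left_commute power_Suc)
      qed
      have "2 ^ Suc k * emeasure \<nu> (cball x (1 / 2 ^ k)) \<le> 2 ^ Suc k * ennreal (C * (1 / 2 ^ k) powr d)"
        by (intro mult_left_mono frost) auto
      also have "\<dots> = ennreal (2 ^ Suc k * (C * (1 / 2 ^ k) powr d))"
        using C by (simp add: ennreal_mult'' ennreal_power[symmetric] ennreal_mult' del: power_Suc)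
      finally show "2 ^ Suc k * emeasure \<nu> (cball x (1 / 2 ^ k)) \<le> ennreal (2 * C * q ^ k)"
        by (simp only: e)
    qed
    also have "\<dots> = ennreal (2 * C / (1 - q))"
    proof -
      have "(\<lambda>k. 2 * C * q ^ k) sums (2 * C * (1 / (1 - q)))"
        using q by (intro sums_mult geometric_sums) auto
      then show ?thesis using C q by (intro suminf_ennreal_eq) auto
    qed
    finally show ?thesis using C q
      by (simp add: B_def emeasure_eq_measure ennreal_plus)
  qed
  then show ?thesis by (rule that)
qed

section \<open>Averaging over the directions of projection\<close>

lemma sets_borel_pair:
  "sets (borel \<Otimes>\<^sub>M borel :: ('a::second_countable_topology \<times> 'b::second_countable_topology) measure) = sets borel"
  by (subst borel_prod) (rule refl)

lemma half_le_abs_sin: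
  fixes u :: real
  assumes "\<bar>u\<bar> \<le> 1" shows "\<bar>u\<bar> / 2 \<le> \<bar>sin u\<bar>"
proof -
  have *: "u / 2 \<le> sin u" if "0 \<le> u" "u \<le> 1" for u :: real
  proof -
    have "sin 0 - 0 / 2 \<le> sin u - u / 2"
    proof (rule DERIV_nonneg_imp_nondecreasing[OF that(1)])
      fix x assume x: "0 \<le> x" "x \<le> u"
      \<comment> \<open>Since pi > 3, the interval [0, 1] lies to the left of pi / 3, where the
        cosine is 1 / 2, the slope to beat.\<close>
      have "cos (pi / 3) \<le> cos x"
        using x that pi_gt3 by (intro cos_monotone_0_pi_le) auto
      then show "\<exists>y. ((\<lambda>u. sin u - u / 2) has_real_derivative y) (at x) \<and> 0 \<le> y"
        by (intro exI[of _ "cos x - 1 / 2"]) (auto intro!: derivative_eq_intros simp: cos_60)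
    qed
    then show ?thesis by simp
  qed
  show ?thesis
    using *[of u] *[of "- u"] assms by (cases "u \<ge> 0") auto
qed

text \<open>Transversality: two admissible directions differ by at most 4 r / |z|, so all of them
  lie around any single one. A window of length 1 excludes the antipodal direction, which projects z
  to the same length, and keeps the sine of a difference comparable to the difference.\<close>

lemma emeasure_small_projection:
  fixes z :: "real \<times> real"
  assumes "r > 0"
  shows "emeasure lborel {\<theta> \<in> {a..a + 1}. \<bar>z \<bullet> (cos \<theta>, sin \<theta>)\<bar> \<le> r} \<le> ennreal (8 * r) * riesz_dom (norm z)"
proof (cases "z = 0")
  case True
  have "emeasure lborel {\<theta> \<in> {a..a + 1}. \<bar>z \<bullet> (cos \<theta>, sin \<theta>)\<bar> \<le> r} \<le> emeasure lborel {a..a + 1}"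
    by (intro emeasure_mono) auto
  \<comment> \<open>For z = 0 all directions are admissible; \<open>riesz_dom 0\<close> dominates 1
    / s for every s > 0, in particular 1 / r.\<close>
  also have "\<dots> = ennreal r * ennreal (1 / r)"
    using assms by (simp flip: ennreal_mult')
  also have "\<dots> \<le> ennreal (8 * r) * riesz_dom (norm z)"
    using assms True by (intro mult_mono inverse_le_riesz_dom ennreal_leI) auto
  finally show ?thesis .
next
  case False
  show ?thesis
  proof (cases "\<exists>\<theta>0 \<in> {a..a + 1}. \<bar>z \<bullet> (cos \<theta>0, sin \<theta>0)\<bar> \<le> r")
    case True
    then obtain \<theta>0 where t0: "\<theta>0 \<in> {a..a+1}" "\<bar>z \<bullet> (cos \<theta>0, sin \<theta>0)\<bar> \<le> r" by blast
    define h where "h = 4 * r / norm z"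
    have sub: "{\<theta> \<in> {a..a + 1}. \<bar>z \<bullet> (cos \<theta>, sin \<theta>)\<bar> \<le> r} \<subseteq> {\<theta>0 - h..\<theta>0 + h}"
    proof
      fix \<theta> assume "\<theta> \<in> {\<theta> \<in> {a..a + 1}. \<bar>z \<bullet> (cos \<theta>, sin \<theta>)\<bar> \<le> r}"
      then have t: "\<theta> \<in> {a..a+1}" "\<bar>z \<bullet> (cos \<theta>, sin \<theta>)\<bar> \<le> r" by auto
      obtain x y where z: "z = (x, y)" by (cases z)
      define p p0 where "p = z \<bullet> (cos \<theta>, sin \<theta>)" and "p0 = z \<bullet> (cos \<theta>0, sin \<theta>0)"
      \<comment> \<open>Cramer's rule: the components p and p0 of z along two directions determine z
        times the determinant sin (\<theta> - \<theta>0).\<close>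
      have "sin (\<theta> - \<theta>0) *\<^sub>R z = p0 *\<^sub>R (sin \<theta>, - cos \<theta>) - p *\<^sub>R (sin \<theta>0, - cos \<theta>0)"
        by (simp add: z p_def p0_def sin_diff algebra_simps)
      then have "\<bar>sin (\<theta> - \<theta>0)\<bar> * norm z = norm (p0 *\<^sub>R (sin \<theta>, - cos \<theta>) - p *\<^sub>R (sin \<theta>0, - cos \<theta>0))"
        by (metis norm_scaleR real_norm_def)
      also have "\<dots> \<le> norm (p0 *\<^sub>R (sin \<theta>, - cos \<theta>)) + norm (p *\<^sub>R (sin \<theta>0, - cos \<theta>0))"
        by (rule norm_triangle_ineq4)
      also have "\<dots> = \<bar>p0\<bar> + \<bar>p\<bar>"
        by (simp only: norm_scaleR norm_Pair) (simp add: add.commute)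
      also have "\<dots> \<le> 2 * r" using t t0 by (simp add: p_def p0_def)
      finally have "\<bar>sin (\<theta> - \<theta>0)\<bar> * norm z \<le> 2 * r" .
      moreover have "\<bar>\<theta> - \<theta>0\<bar> / 2 \<le> \<bar>sin (\<theta> - \<theta>0)\<bar>"
        using t t0 by (intro half_le_abs_sin) auto
      ultimately have "\<bar>\<theta> - \<theta>0\<bar> / 2 * norm z \<le> 2 * r"
        by (meson mult_right_mono norm_ge_zero order_trans)
      then have "\<bar>\<theta> - \<theta>0\<bar> \<le> h" using False by (simp add: h_def field_simps)
      then show "\<theta> \<in> {\<theta>0 - h..\<theta>0 + h}" by auto
    qed
    have h: "h > 0" using assms False by (simp add: h_def)
    have "emeasure lborel {\<theta> \<in> {a..a + 1}. \<bar>z \<bullet> (cos \<theta>, sin \<theta>)\<bar> \<le> r} \<le> emeasure lborel {\<theta>0 - h..\<theta>0 + h}"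
      by (intro emeasure_mono sub) auto
    also have "\<dots> = ennreal (8 * r) * ennreal (1 / norm z)"
      using h assms by (simp add: h_def flip: ennreal_mult')
    also have "\<dots> \<le> ennreal (8 * r) * riesz_dom (norm z)"
      using False by (intro mult_left_mono inverse_le_riesz_dom) auto
    finally show ?thesis .
  next
    case False
    then have "{\<theta> \<in> {a..a + 1}. \<bar>z \<bullet> (cos \<theta>, sin \<theta>)\<bar> \<le> r} = {}" by blast
    then show ?thesis by (simp only: emeasure_empty zero_le)
  qed
qed

lemma AE_absolutely_continuous_projection:
  fixes \<nu> :: "(real \<times> real) measure"
  assumes "finite_measure \<nu>" and [measurable_cong, simp]: "sets \<nu> = sets borel"
    and C: "C \<ge> 0" "d > 1"
    and frost: "\<And>z R. 0 < R \<Longrightarrow> R \<le> 1 \<Longrightarrow> emeasure \<nu> (cball z R) \<le> ennreal (C * R powr d)"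
  shows "AE \<theta> in lborel. absolutely_continuous lborel (distr \<nu> borel (\<lambda>x. x \<bullet> (cos \<theta>, sin \<theta>)))"
proof -
  interpret finite_measure \<nu> by fact
  interpret N2: pair_sigma_finite \<nu> \<nu>
    by (simp add: pair_sigma_finite_def sigma_finite_measure_axioms)
  interpret X: pair_sigma_finite lborel "\<nu> \<Otimes>\<^sub>M \<nu>"
    by (simp add: pair_sigma_finite_def sigma_finite_lborel N2.sigma_finite_measure_axioms)
  have [simp]: "space \<nu> = UNIV" using sets_eq_imp_space_eq[of \<nu> borel] by simp
  obtain B where B: "\<And>x. (\<integral>\<^sup>+y. riesz_dom (dist x y) \<partial>\<nu>) \<le> ennreal B"
    using nn_integral_riesz_dom[OF assms(1-4) frost] by blast
  define r :: "nat \<Rightarrow> real" where "r n = 1 / real (Suc n)" for n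
  have r: "r n > 0" for n by (simp add: r_def)
  have r0: "r \<longlonglongrightarrow> 0" unfolding r_def by (rule LIMSEQ_inverse_real_of_nat[unfolded inverse_eq_divide])
  define D where "D n \<theta> = {z::(real \<times> real) \<times> (real \<times> real). \<bar>(fst z - snd z) \<bullet> (cos \<theta>, sin \<theta>)\<bar> \<le> 2 * r n}" for n \<theta>
  define E where "E n \<theta> = emeasure (\<nu> \<Otimes>\<^sub>M \<nu>) (D n \<theta>)" for n \<theta>
  \<comment> \<open>The close pairs for all directions at once: a closed set, which gives the joint
    measurability that Tonelli requires.\<close>
  define DD where "DD n = {w::real \<times> (real \<times> real) \<times> (real \<times> real). snd w \<in> D n (fst w)}" for n
  have sets_N2: "sets (\<nu> \<Otimes>\<^sub>M \<nu>) = sets borel"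
    by (simp add: sets_borel_pair cong: sets_pair_measure_cong)
  have DD[measurable]: "DD n \<in> sets (lborel \<Otimes>\<^sub>M (\<nu> \<Otimes>\<^sub>M \<nu>))" for n
  proof -
    have "closed (DD n)" unfolding DD_def D_def mem_Collect_eq
      by (intro closed_Collect_le continuous_intros)
    then have "DD n \<in> sets (borel :: (real \<times> (real \<times> real) \<times> (real \<times> real)) measure)" by simp
    also have "sets (borel :: (real \<times> (real \<times> real) \<times> (real \<times> real)) measure) = sets (lborel \<Otimes>\<^sub>M (\<nu> \<Otimes>\<^sub>M \<nu>))"
      by (simp add: sets_N2 sets_borel_pair cong: sets_pair_measure_cong)
    finally show ?thesis .
  qed
  have D[measurable]: "D n \<theta> \<in> sets (\<nu> \<Otimes>\<^sub>M \<nu>)" for n \<theta>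
  proof -
    have "closed (D n \<theta>)" unfolding D_def
      by (intro closed_Collect_le continuous_intros)
    then have "D n \<theta> \<in> sets borel" by simp
    then show ?thesis by (simp only: sets_N2)
  qed
  have E_eq: "E n \<theta> = (\<integral>\<^sup>+z. indicator (DD n) (\<theta>, z) \<partial>(\<nu> \<Otimes>\<^sub>M \<nu>))" for n \<theta>
  proof -
    have "(\<integral>\<^sup>+z. indicator (DD n) (\<theta>, z) \<partial>(\<nu> \<Otimes>\<^sub>M \<nu>)) = (\<integral>\<^sup>+z. indicator (D n \<theta>) z \<partial>(\<nu> \<Otimes>\<^sub>M \<nu>))"
      by (intro nn_integral_cong) (simp add: indicator_def DD_def)
    then show ?thesis using D by (simp add: E_def)
  qed
  have Em[measurable]: "E n \<in> borel_measurable lborel" for n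
    unfolding E_eq[abs_def] by measurable
  \<comment> \<open>The transversality estimate holds on unit windows only; those with integer ends
    cover the line, and countably many exceptional null sets remain null.\<close>
  have AEa: "AE \<theta> in lborel. \<theta> \<in> {a..a + 1} \<longrightarrow> liminf (\<lambda>n. E n \<theta> / ennreal (r n)) < top" for a :: real
  proof -
    have bound: "(\<integral>\<^sup>+\<theta>. E n \<theta> / ennreal (r n) * indicator {a..a + 1} \<theta> \<partial>lborel) \<le> 16 * (ennreal B * emeasure \<nu> UNIV)" for n
    proof -
      have "(\<integral>\<^sup>+\<theta>. E n \<theta> * indicator {a..a + 1} \<theta> \<partial>lborel)
        = (\<integral>\<^sup>+\<theta>. (\<integral>\<^sup>+z. indicator (DD n) (\<theta>, z) * indicator {a..a + 1} \<theta> \<partial>(\<nu> \<Otimes>\<^sub>M \<nu>)) \<partial>lborel)"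
        unfolding E_eq by (intro nn_integral_cong nn_integral_multc[symmetric]) measurable
      also have "\<dots> = (\<integral>\<^sup>+z. (\<integral>\<^sup>+\<theta>. indicator (DD n) (\<theta>, z) * indicator {a..a + 1} \<theta> \<partial>lborel) \<partial>(\<nu> \<Otimes>\<^sub>M \<nu>))"
        by (rule X.Fubini'[symmetric]) measurable
      also have "\<dots> \<le> (\<integral>\<^sup>+z. ennreal (16 * r n) * riesz_dom (dist (fst z) (snd z)) \<partial>(\<nu> \<Otimes>\<^sub>M \<nu>))"
      proof (rule nn_integral_mono)
        fix z :: "(real \<times> real) \<times> (real \<times> real)"
        let ?S = "{\<theta> \<in> {a..a + 1}. \<bar>(fst z - snd z) \<bullet> (cos \<theta>, sin \<theta>)\<bar> \<le> 2 * r n}"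
        have "?S = {a..a+1} \<inter> {\<theta>. \<bar>(fst z - snd z) \<bullet> (cos \<theta>, sin \<theta>)\<bar> \<le> 2 * r n}" by blast
        moreover have "closed {\<theta>. \<bar>(fst z - snd z) \<bullet> (cos \<theta>, sin \<theta>)\<bar> \<le> 2 * r n}"
          by (intro closed_Collect_le continuous_intros)
        ultimately have S: "?S \<in> sets lborel" by simp
        have "(\<integral>\<^sup>+\<theta>. indicator (DD n) (\<theta>, z) * indicator {a..a + 1} \<theta> \<partial>lborel) = (\<integral>\<^sup>+\<theta>. indicator ?S \<theta> \<partial>lborel)"
          by (intro nn_integral_cong) (auto simp: indicator_def DD_def D_def)
        also have "\<dots> = emeasure lborel ?S" using S by simp
        also have "\<dots> \<le> ennreal (8 * (2 * r n)) * riesz_dom (norm (fst z - snd z))"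
          using r by (intro emeasure_small_projection) simp
        finally show "(\<integral>\<^sup>+\<theta>. indicator (DD n) (\<theta>, z) * indicator {a..a + 1} \<theta> \<partial>lborel)
           \<le> ennreal (16 * r n) * riesz_dom (dist (fst z) (snd z))"
          by (simp add: dist_norm)
      qed
      also have "\<dots> = ennreal (16 * r n) * (\<integral>\<^sup>+z. riesz_dom (dist (fst z) (snd z)) \<partial>(\<nu> \<Otimes>\<^sub>M \<nu>))"
        by (rule nn_integral_cmult) measurable
      also have "(\<integral>\<^sup>+z. riesz_dom (dist (fst z) (snd z)) \<partial>(\<nu> \<Otimes>\<^sub>M \<nu>)) = (\<integral>\<^sup>+x. (\<integral>\<^sup>+y. riesz_dom (dist x y) \<partial>\<nu>) \<partial>\<nu>)"
        by (subst nn_integral_fst[symmetric]) simp_all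
      also have "\<dots> \<le> (\<integral>\<^sup>+x. ennreal B \<partial>\<nu>)"
        by (intro nn_integral_mono B)
      also have "\<dots> = ennreal B * emeasure \<nu> UNIV" by simp
      finally have *: "(\<integral>\<^sup>+\<theta>. E n \<theta> * indicator {a..a + 1} \<theta> \<partial>lborel) \<le> ennreal (16 * r n) * (ennreal B * emeasure \<nu> UNIV)"
        by (simp add: mult_left_mono)
      have "(\<integral>\<^sup>+\<theta>. E n \<theta> / ennreal (r n) * indicator {a..a + 1} \<theta> \<partial>lborel) =
         (\<integral>\<^sup>+\<theta>. inverse (ennreal (r n)) * (E n \<theta> * indicator {a..a + 1} \<theta>) \<partial>lborel)"
        by (simp only: divide_ennreal_def ac_simps)
      also have "\<dots> = inverse (ennreal (r n)) * (\<integral>\<^sup>+\<theta>. E n \<theta> * indicator {a..a + 1} \<theta> \<partial>lborel)"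
        by (rule nn_integral_cmult) measurable
      also have "\<dots> \<le> inverse (ennreal (r n)) * (ennreal (16 * r n) * (ennreal B * emeasure \<nu> UNIV))"
        by (intro mult_left_mono *) auto
      also have "\<dots> = (inverse (ennreal (r n)) * ennreal (16 * r n)) * (ennreal B * emeasure \<nu> UNIV)"
        by (simp only: ac_simps)
      also have "inverse (ennreal (r n)) * ennreal (16 * r n) = 16"
      proof -
        have "inverse (ennreal (r n)) * ennreal (16 * r n) = ennreal (inverse (r n) * (16 * r n))"
          using r[of n] by (simp add: inverse_ennreal flip: ennreal_mult')
        also have "inverse (r n) * (16 * r n) = 16" using r[of n] by simp
        finally show ?thesis by simp
      qed
      finally show ?thesis .
    qed
    have "(\<integral>\<^sup>+\<theta>. liminf (\<lambda>n. E n \<theta> / ennreal (r n) * indicator {a..a + 1} \<theta>) \<partial>lborel)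
      \<le> liminf (\<lambda>n. \<integral>\<^sup>+\<theta>. E n \<theta> / ennreal (r n) * indicator {a..a + 1} \<theta> \<partial>lborel)"
      by (rule nn_integral_liminf) measurable
    also have "\<dots> \<le> liminf (\<lambda>n::nat. 16 * (ennreal B * emeasure \<nu> UNIV))"
      by (intro Liminf_mono always_eventually allI bound)
    also have "\<dots> = 16 * (ennreal B * emeasure \<nu> UNIV)" by (simp add: Liminf_const)
    also have "\<dots> < top" by (simp add: ennreal_mult_less_top ennreal_mult_eq_top_iff less_top[symmetric])
    finally have "(\<integral>\<^sup>+\<theta>. liminf (\<lambda>n. E n \<theta> / ennreal (r n) * indicator {a..a + 1} \<theta>) \<partial>lborel) \<noteq> \<infinity>"
      by simp
    then have "AE \<theta> in lborel. liminf (\<lambda>n. E n \<theta> / ennreal (r n) * indicator {a..a + 1} \<theta>) \<noteq> \<infinity>"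
      by (intro nn_integral_noteq_infinite) measurable
    then show ?thesis
      by eventually_elim (auto simp: less_top indicator_def)
  qed
  have "AE \<theta> in lborel. \<forall>i::int. \<theta> \<in> {real_of_int i..real_of_int i + 1} \<longrightarrow> liminf (\<lambda>n. E n \<theta> / ennreal (r n)) < top"
    unfolding AE_all_countable using AEa by blast
  then show ?thesis
  proof eventually_elim
    case (elim \<theta>)
    have lim: "liminf (\<lambda>n. E n \<theta> / ennreal (r n)) < top"
      using elim[rule_format, of "\<lfloor>\<theta>\<rfloor>"] floor_correct[of \<theta>] by force
    let ?p = "\<lambda>x::real \<times> real. x \<bullet> (cos \<theta>, sin \<theta>)"
    let ?\<mu> = "distr \<nu> borel ?p"
    have p[measurable]: "?p \<in> \<nu> \<rightarrow>\<^sub>M borel" by measurable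
    have fin: "finite_measure ?\<mu>" by (rule finite_measure_distr[OF p])
    have "emeasure (?\<mu> \<Otimes>\<^sub>M ?\<mu>) {z. \<bar>fst z - snd z\<bar> \<le> 2 * r n} = E n \<theta>" for n
    proof -
      have 1: "?\<mu> \<Otimes>\<^sub>M ?\<mu> = distr (\<nu> \<Otimes>\<^sub>M \<nu>) (borel \<Otimes>\<^sub>M borel) (\<lambda>(x, y). (?p x, ?p y))"
        using fin by (intro pair_measure_distr) (auto simp: finite_measure_def)
      have 2: "closed {z::real \<times> real. \<bar>fst z - snd z\<bar> \<le> 2 * r n}"
        by (intro closed_Collect_le continuous_intros)
      have 3: "emeasure (distr (\<nu> \<Otimes>\<^sub>M \<nu>) (borel \<Otimes>\<^sub>M borel) (\<lambda>(x, y). (?p x, ?p y))) {z. \<bar>fst z - snd z\<bar> \<le> 2 * r n}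
         = emeasure (\<nu> \<Otimes>\<^sub>M \<nu>) ((\<lambda>(x, y). (?p x, ?p y)) -` {z. \<bar>fst z - snd z\<bar> \<le> 2 * r n} \<inter> space (\<nu> \<Otimes>\<^sub>M \<nu>))"
        using 2 by (intro emeasure_distr) (measurable, simp add: sets_borel_pair)
      have 4: "(\<lambda>(x, y). (?p x, ?p y)) -` {z. \<bar>fst z - snd z\<bar> \<le> 2 * r n} \<inter> space (\<nu> \<Otimes>\<^sub>M \<nu>) = D n \<theta>"
        by (auto simp: D_def space_pair_measure inner_diff_left)
      show ?thesis by (simp only: 1 3 4 E_def)
    qed
    then show ?case
      by (intro absolutely_continuous_of_liminf_energy[OF fin _ r r0]) (use lim in auto)
  qed
qed

section \<open>Covers and separated sets\<close>

definition separated :: "real \<Rightarrow> 'a::metric_space set \<Rightarrow> bool" where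
  "separated \<rho> S \<longleftrightarrow> (\<forall>x\<in>S. \<forall>y\<in>S. x \<noteq> y \<longrightarrow> \<rho> \<le> dist x y)"

text \<open>Infinite descent on the number of covering sets: a set of diameter less than \<open>e\<close> meets at most one
  of the images \<open>\<phi> i ` K\<close>, so the cheapest image is covered by fewer sets, and pulling these back along
  \<open>\<phi> i\<close> gives a cover of \<open>K\<close> that is no more expensive than the original one.\<close>

lemma no_small_cover:
  fixes K :: "'a::metric_space set" and \<phi> :: "'i \<Rightarrow> 'a \<Rightarrow> 'a" and U :: "'j \<Rightarrow> 'a set"
  assumes K: "K \<noteq> {}" and I: "finite I" "2 \<le> card I"
    and into: "\<And>i x. i \<in> I \<Longrightarrow> x \<in> K \<Longrightarrow> \<phi> i x \<in> K"
    and contr: "\<And>i x y. i \<in> I \<Longrightarrow> x \<in> K \<Longrightarrow> y \<in> K \<Longrightarrow> b * dist x y \<le> dist (\<phi> i x) (\<phi> i y)"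
    and sep: "\<And>i j x y. i \<in> I \<Longrightarrow> j \<in> I \<Longrightarrow> i \<noteq> j \<Longrightarrow> x \<in> K \<Longrightarrow> y \<in> K \<Longrightarrow> e \<le> dist (\<phi> i x) (\<phi> j y)"
    and pos: "0 < b" "0 < e" "0 < t" and big: "1 \<le> real (card I) * b powr t"
    and A: "finite A" "K \<subseteq> (\<Union>j\<in>A. U j)"
    and g: "\<And>j. j \<in> A \<Longrightarrow> 0 \<le> g j" "\<And>j x y. j \<in> A \<Longrightarrow> x \<in> U j \<Longrightarrow> y \<in> U j \<Longrightarrow> dist x y \<le> g j"
  shows "e powr t \<le> (\<Sum>j\<in>A. g j powr t)"
  using A g
proof (induction A arbitrary: U g rule: finite_psubset_induct)
  case (psubset A)
  show ?case
  proof (rule ccontr)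
    assume neg: "\<not> e powr t \<le> (\<Sum>j\<in>A. g j powr t)"
    \<comment> \<open>A set with bound e or more would already pay \<open>e powr t\<close> by
      itself.\<close>
    have gA: "g j < e" if "j \<in> A" for j
    proof -
      have "g j powr t \<le> (\<Sum>j\<in>A. g j powr t)"
        using that psubset.hyps by (intro member_le_sum) auto
      then have "g j powr t < e powr t" using neg by simp
      then show ?thesis
        using pos psubset.prems(2)[OF that] powr_mono2[of t e "g j"] by (metis less_imp_le not_le)
    qed
    define AA where "AA i = {j \<in> A. U j \<inter> \<phi> i ` K \<noteq> {}}" for i
    have ne: "AA i \<noteq> {}" if "i \<in> I" for i
    proof -
      obtain x where "x \<in> K" using K by blast
      then have "\<phi> i x \<in> (\<Union>j\<in>A. U j)" using into[OF that] psubset.prems(1) by blast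
      then show ?thesis using \<open>x \<in> K\<close> by (auto simp: AA_def)
    qed
    have disj: "AA i \<inter> AA k = {}" if "i \<in> I" "k \<in> I" "i \<noteq> k" for i k
    proof (rule ccontr)
      assume "AA i \<inter> AA k \<noteq> {}"
      then obtain j x y where j: "j \<in> A" "x \<in> K" "y \<in> K" "\<phi> i x \<in> U j" "\<phi> k y \<in> U j"
        by (auto simp: AA_def)
      then show False using sep[OF that j(2,3)] psubset.prems(3)[OF j(1,4,5)] gA[OF j(1)] by linarith
    qed
    have fin: "finite (AA i)" for i using psubset.hyps by (simp add: AA_def)
    have "(\<Sum>i\<in>I. \<Sum>j\<in>AA i. g j powr t) = (\<Sum>j\<in>(\<Union>i\<in>I. AA i). g j powr t)"
      using disj fin I by (subst sum.UNION_disjoint) auto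
    also have "\<dots> \<le> (\<Sum>j\<in>A. g j powr t)"
      using psubset.hyps by (intro sum_mono2) (auto simp: AA_def)
    finally have tot: "(\<Sum>i\<in>I. \<Sum>j\<in>AA i. g j powr t) \<le> (\<Sum>j\<in>A. g j powr t)" .
    have "\<exists>i\<in>I. real (card I) * (\<Sum>j\<in>AA i. g j powr t) \<le> (\<Sum>j\<in>A. g j powr t)"
    proof (rule ccontr)
      assume "\<not> ?thesis"
      then have "(\<Sum>i\<in>I. \<Sum>j\<in>A. g j powr t) < (\<Sum>i\<in>I. real (card I) * (\<Sum>j\<in>AA i. g j powr t))"
        using I by (intro sum_strict_mono) (auto simp: not_le)
      also have "\<dots> \<le> real (card I) * (\<Sum>j\<in>A. g j powr t)"
        using tot by (simp add: sum_distrib_left[symmetric] mult_left_mono)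
      finally show False by simp
    qed
    then obtain i where i: "i \<in> I" "real (card I) * (\<Sum>j\<in>AA i. g j powr t) \<le> (\<Sum>j\<in>A. g j powr t)"
      by blast
    \<comment> \<open>A second image needs sets of its own, disjoint from those meeting image i.
      Thus \<open>AA i\<close> is a proper subset of A and the descent terminates.\<close>
    obtain k where k: "k \<in> I" "k \<noteq> i"
    proof -
      have "I \<noteq> {i}" using I(2) by (metis card.empty card.insert empty_iff finite.emptyI not_less_eq_eq numeral_2_eq_2 order_refl)
      then show ?thesis using that i(1) by blast
    qed
    have "AA i \<subseteq> A" "AA k \<subseteq> A" by (auto simp: AA_def)
    then have "AA i \<subset> A" using ne[OF k(1)] disj[OF i(1) k(1)] k(2) by blast
    moreover have "K \<subseteq> (\<Union>j\<in>AA i. {x \<in> K. \<phi> i x \<in> U j})"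
      using into[OF i(1)] psubset.prems(1) by (force simp: AA_def)
    moreover have "0 \<le> g j / b" if "j \<in> AA i" for j
      using that pos psubset.prems(2) by (simp add: AA_def)
    moreover have "dist x y \<le> g j / b"
      if "j \<in> AA i" "x \<in> {x \<in> K. \<phi> i x \<in> U j}" "y \<in> {x \<in> K. \<phi> i x \<in> U j}" for j x y
    proof -
      have "b * dist x y \<le> g j"
        using contr[OF i(1), of x y] psubset.prems(3)[of j "\<phi> i x" "\<phi> i y"] that by (auto simp: AA_def)
      then show ?thesis using pos by (simp add: field_simps)
    qed
    ultimately have "e powr t \<le> (\<Sum>j\<in>AA i. (g j / b) powr t)"
      by (rule psubset.IH)
    also have "\<dots> = (\<Sum>j\<in>AA i. g j powr t) / b powr t"
      using pos psubset.prems(2) by (simp add: powr_divide sum_divide_distrib AA_def)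
    finally have *: "e powr t * b powr t \<le> (\<Sum>j\<in>AA i. g j powr t)"
      using pos by (simp add: field_simps)
    \<comment> \<open>Pulling back costs the factor \<open>b powr (- t)\<close>, choosing the
      cheapest of \<open>card I\<close> images gains the factor \<open>card I\<close>;
      \<open>big\<close> says that the gain covers the loss.\<close>
    have "e powr t \<le> e powr t * (real (card I) * b powr t)"
      using big by (simp add: mult_le_cancel_left1)
    also have "\<dots> = real (card I) * (e powr t * b powr t)" by simp
    also have "\<dots> \<le> real (card I) * (\<Sum>j\<in>AA i. g j powr t)"
      by (intro mult_left_mono *) auto
    finally show False using i(2) neg by linarith
  qed
qed

text \<open>Compactness reduces countable covers to finite ones. One half of c bounds the cost of
  the given cover, the other half pays for fattening its sets to open ones.\<close>

lemma hausdorff_outer_nonzero: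
  fixes K :: "'a::metric_space set"
  assumes "compact K" and pos: "0 < t" "0 < c"
    and cov: "\<And>(A::nat set) U g. finite A \<Longrightarrow> K \<subseteq> (\<Union>j\<in>A. U j) \<Longrightarrow> (\<And>j. j \<in> A \<Longrightarrow> 0 \<le> g j) \<Longrightarrow>
      (\<And>j x y. j \<in> A \<Longrightarrow> x \<in> U j \<Longrightarrow> y \<in> U j \<Longrightarrow> dist x y \<le> g j) \<Longrightarrow> c \<le> (\<Sum>j\<in>A. g j powr t)"
  shows "hausdorff_outer t K \<noteq> 0"
proof
  assume "hausdorff_outer t K = 0"
  then have "hausdorff_content t 1 K \<le> 0"
    using hausdorff_content_le_outer[of 1 t K] by simp
  then have "hausdorff_content t 1 K < ennreal (c / 2)" using pos by (simp add: order_le_less_trans)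
  then obtain U :: "nat \<Rightarrow> 'a set" where U: "K \<subseteq> (\<Union>n. U n)" "\<And>n. bounded (U n)"
      and sumU: "(\<Sum>n. diam_power t (U n)) < ennreal (c / 2)"
    unfolding hausdorff_content_def by (subst (asm) INF_less_iff) auto
  define a where "a n = diameter (U n)" for n
  have a0: "a n \<ge> 0" for n using U by (simp add: a_def diameter_ge_0)
  have dp: "diam_power t (U n) = ennreal (a n powr t)" for n
    using pos by (simp add: diam_power_def a_def)
  \<comment> \<open>Continuity of the power from the right at \<open>a n\<close>, including
    \<open>a n = 0\<close>, which occurs for singletons. The extra costs sum to at most c /
    2.\<close>
  have "\<exists>h>0. (a n + 2 * h) powr t < a n powr t + c / 2 * (1 / 2) ^ Suc n" for n
  proof -
    have "((\<lambda>h. (a n + 2 * h) powr t) \<longlongrightarrow> (a n + 2 * 0) powr t) (at_right 0)"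
      using pos a0[of n]
      by (intro tendsto_powr' tendsto_intros) (auto simp: eventually_at_right_less intro!: eventually_at_rightI[of 0 1])
    then have "\<forall>\<^sub>F h in at_right 0. (a n + 2 * h) powr t < a n powr t + c / 2 * (1 / 2) ^ Suc n"
      using pos by (intro order_tendstoD(2)) auto
    then have "\<forall>\<^sub>F h in at_right 0. h > 0 \<and> (a n + 2 * h) powr t < a n powr t + c / 2 * (1 / 2) ^ Suc n"
      by (intro eventually_conj eventually_at_right_less)
    then show ?thesis using eventually_happens by fastforce
  qed
  then obtain h where h: "\<And>n. h n > 0" "\<And>n. (a n + 2 * h n) powr t < a n powr t + c / 2 * (1 / 2) ^ Suc n"
    by metis
  define V where "V n = (\<Union>x\<in>U n. ball x (h n))" for n
  have open_V: "open (V n)" for n by (auto simp: V_def)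
  have "U n \<subseteq> V n" for n using h(1)[of n] by (auto simp: V_def)
  then have cov_V: "K \<subseteq> \<Union> (range V)" by (intro order_trans[OF U(1)] UN_mono) auto
  have "\<exists>A. finite A \<and> K \<subseteq> (\<Union>n\<in>A. V n)"
    by (rule compactE_image[OF \<open>compact K\<close> open_V cov_V]) blast
  then obtain A where A: "finite A" "K \<subseteq> (\<Union>n\<in>A. V n)" by blast
  have "c \<le> (\<Sum>n\<in>A. (a n + 2 * h n) powr t)"
  proof (rule cov[OF A])
    show "0 \<le> a n + 2 * h n" for n using a0[of n] h(1)[of n] by simp
    fix n x y assume "x \<in> V n" "y \<in> V n"
    then obtain x' y' where x': "x' \<in> U n" "dist x' x < h n" "y' \<in> U n" "dist y' y < h n"
      by (auto simp: V_def)
    have "dist x' y' \<le> a n" unfolding a_def using x' U(2) by (intro diameter_bounded_bound) auto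
    then show "dist x y \<le> a n + 2 * h n"
      using x' dist_triangle[of x y x'] dist_triangle[of x' y y'] by (simp add: dist_commute)
  qed
  also have "\<dots> \<le> (\<Sum>n\<in>A. a n powr t + c / 2 * (1 / 2) ^ Suc n)"
    by (intro sum_mono less_imp_le h)
  also have "\<dots> = (\<Sum>n\<in>A. a n powr t) + c / 2 * (\<Sum>n\<in>A. (1 / 2) ^ Suc n)"
    by (simp add: sum.distrib sum_distrib_left)
  also have "(\<Sum>n\<in>A. (1 / 2) ^ Suc n) \<le> (1::real)"
    using sum_le_suminf[OF sums_summable[OF power_half_series] A(1)] sums_unique[OF power_half_series] by simp
  also have "(\<Sum>n\<in>A. a n powr t) < c / 2"
  proof -
    have "ennreal (\<Sum>n\<in>A. a n powr t) = (\<Sum>n\<in>A. diam_power t (U n))"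
      by (simp add: dp sum_ennreal)
    also have "\<dots> \<le> (\<Sum>n. diam_power t (U n))" using A by (intro sum_le_suminf) auto
    finally have "ennreal (\<Sum>n\<in>A. a n powr t) < ennreal (c / 2)" using sumU by simp
    then show ?thesis by (simp add: ennreal_less_iff sum_nonneg)
  qed
  finally show False using pos by simp
qed

text \<open>For diameters at most 1 the larger exponent gives the smaller power. Capping the scale
  at 1 only increases the content.\<close>

lemma hausdorff_outer_0_mono:
  fixes A :: "'a::metric_space set"
  assumes "hausdorff_outer s A = 0" "0 \<le> s" "s \<le> t"
  shows "hausdorff_outer t A = 0"
proof -
  have "hausdorff_content t \<epsilon> A \<le> 0" if "\<epsilon> > 0" for \<epsilon>
  proof -
    have "hausdorff_content t \<epsilon> A \<le> hausdorff_content t (min \<epsilon> 1) A"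
      by (rule hausdorff_content_antimono) simp
    also have "\<dots> \<le> hausdorff_content s (min \<epsilon> 1) A"
      unfolding hausdorff_content_def
    proof (rule INF_mono)
      fix U :: "nat \<Rightarrow> 'a set"
      assume U: "U \<in> {U. A \<subseteq> (\<Union>n. U n) \<and> (\<forall>n. bounded (U n) \<and> diameter (U n) < min \<epsilon> 1)}"
      have "diam_power t (U n) \<le> diam_power s (U n)" for n
      proof -
        have "0 \<le> diameter (U n)" "diameter (U n) \<le> 1"
          using U by (auto intro: diameter_ge_0 less_imp_le)
        then show ?thesis
          using assms(2,3) powr_le_one_le[of "diameter (U n)" t] 
          by (auto simp: diam_power_def powr_mono' powr_le1 intro!: ennreal_leI)
      qed
      then show "\<exists>V\<in>{U. A \<subseteq> (\<Union>n. U n) \<and> (\<forall>n. bounded (U n) \<and> diameter (U n) < min \<epsilon> 1)}.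
          (\<Sum>n. diam_power t (V n)) \<le> (\<Sum>n. diam_power s (U n))"
        using U by (intro bexI[of _ U] suminf_le) auto
    qed
    also have "\<dots> \<le> hausdorff_outer s A"
      using that by (intro hausdorff_content_le_outer) simp
    finally show ?thesis using assms(1) by simp
  qed
  then have "hausdorff_outer t A \<le> 0"
    unfolding hausdorff_outer_eq_SUP by (intro SUP_least) auto
  then show ?thesis by simp
qed

lemma hausdorff_content_le_card:
  fixes A :: "'a::metric_space set" and U :: "'j \<Rightarrow> 'a set"
  assumes J: "finite J" "A \<subseteq> (\<Union>j\<in>J. U j)"
    and U: "\<And>j. j \<in> J \<Longrightarrow> bounded (U j)" "\<And>j. j \<in> J \<Longrightarrow> diameter (U j) \<le> \<eta>"
    and pos: "0 \<le> \<eta>" "\<eta> < \<epsilon>" "0 < s"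
  shows "hausdorff_content s \<epsilon> A \<le> ennreal (real (card J) * \<eta> powr s)"
proof -
  obtain h where h: "bij_betw h {..<card J} J"
    using J(1) by (metis atLeast0LessThan ex_bij_betw_nat_finite)
  define V where "V n = (if n < card J then U (h n) else {})" for n
  have hJ: "h n \<in> J" if "n < card J" for n using h that by (auto simp: bij_betw_def)
  have "A \<subseteq> (\<Union>n. V n)"
  proof
    fix x assume "x \<in> A"
    then obtain j where "j \<in> J" "x \<in> U j" using J by blast
    then obtain n where "n < card J" "h n = j" using h unfolding bij_betw_def by (metis imageE lessThan_iff)
    then show "x \<in> (\<Union>n. V n)" using \<open>x \<in> U j\<close> by (auto simp: V_def)
  qed
  then have "hausdorff_content s \<epsilon> A \<le> (\<Sum>n. diam_power s (V n))"
    unfolding hausdorff_content_def using U hJ pos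
    by (intro INF_lower) (force simp: V_def intro: le_less_trans)
  also have "\<dots> = (\<Sum>n<card J. diam_power s (V n))"
    by (rule suminf_finite) (auto simp: V_def)
  also have "\<dots> \<le> (\<Sum>n<card J. ennreal (\<eta> powr s))"
  proof (rule sum_mono)
    fix n assume "n \<in> {..<card J}"
    then have "diameter (V n) \<le> \<eta>" "0 \<le> diameter (V n)"
      using U hJ by (auto simp: V_def diameter_ge_0)
    then show "diam_power s (V n) \<le> ennreal (\<eta> powr s)"
      using pos by (auto simp: diam_power_def intro!: ennreal_leI powr_mono2)
  qed
  also have "\<dots> = ennreal (real (card J) * \<eta> powr s)"
    by (simp add: ennreal_mult'' ennreal_of_nat_eq_real_of_nat)
  finally show ?thesis .
qed

text \<open>The exponent 2 shows that the set whose infimum is \<open>hausdorff_dim\<close> is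
  nonempty for subsets of the unit interval: n + 1 intervals of length 1 / n cost about 1 /
  n.\<close>

lemma hausdorff_outer_2_unit_interval: "hausdorff_outer 2 {0..1::real} = 0"
proof -
  have "hausdorff_content 2 \<epsilon> {0..1::real} \<le> 0" if "\<epsilon> > 0" for \<epsilon>
  proof (rule ennreal_le_epsilon)
    fix e :: real assume "e > 0"
    obtain N where N: "1 / real (Suc N) < min \<epsilon> (e / 2)"
      by (rule nat_approx_posE[of "min \<epsilon> (e / 2)"]) (use \<open>\<epsilon> > 0\<close> \<open>e > 0\<close> in auto)
    let ?n = "Suc N"
    let ?U = "\<lambda>i::nat. {real i / ?n .. (real i + 1) / ?n}"
    have cov: "{0..1} \<subseteq> (\<Union>i\<in>{..?n}. ?U i)"
    proof
      fix x :: real assume x: "x \<in> {0..1}"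
      define i where "i = nat \<lfloor>x * ?n\<rfloor>"
      have "real i \<le> x * ?n" "x * ?n < real i + 1" using x by (auto simp: i_def of_nat_nat)
      moreover have "x * ?n \<le> ?n" using x by (simp add: mult_le_cancel_right1)
      ultimately have "i \<le> ?n" "x \<in> ?U i"
        by (simp_all add: field_simps flip: of_nat_le_iff[where 'a=real])
      then show "x \<in> (\<Union>i\<in>{..?n}. ?U i)" by blast
    qed
    have dm: "diameter (?U i) \<le> 1 / ?n" for i
      by (simp add: diameter_closed_interval diff_divide_distrib[symmetric] add_divide_distrib)
    have "hausdorff_content 2 \<epsilon> {0..1::real} \<le> ennreal (real (card {..?n}) * (1 / ?n) powr 2)"
      by (rule hausdorff_content_le_card[OF _ cov _ dm]) (use N in auto)
    also have "\<dots> \<le> ennreal e"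
    proof (rule ennreal_leI)
      have "real (card {..?n}) * (1 / ?n) powr 2 = (1 + 1 / ?n) * (1 / ?n)"
        by (simp add: field_simps power2_eq_square)
      also have "\<dots> \<le> 2 * (e / 2)" using N by (intro mult_mono) auto
      finally show "real (card {..?n}) * (1 / ?n) powr 2 \<le> e" by simp
    qed
    finally show "hausdorff_content 2 \<epsilon> {0..1::real} \<le> 0 + ennreal e" by simp
  qed
  then have "hausdorff_outer 2 {0..1::real} \<le> 0"
    unfolding hausdorff_outer_eq_SUP by (intro SUP_least) auto
  then show ?thesis by simp
qed

lemma
  fixes K :: "real set"
  assumes "K \<subseteq> {0..1}"
  shows hausdorff_dim_nonneg: "0 \<le> hausdorff_dim K"
    and hausdorff_outer_eq_0: "hausdorff_dim K < t \<Longrightarrow> hausdorff_outer t K = 0"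
proof -
  have "hausdorff_outer 2 K = 0"
    using hausdorff_outer_mono[OF assms, of 2] hausdorff_outer_2_unit_interval by simp
  then have ne: "{s. 0 \<le> s \<and> hausdorff_outer s K = 0} \<noteq> {}" by (auto intro: exI[of _ 2])
  then show "0 \<le> hausdorff_dim K" unfolding hausdorff_dim_def by (intro cInf_greatest) auto
  show "hausdorff_outer t K = 0" if "hausdorff_dim K < t"
    using cInf_lessD[OF ne that[unfolded hausdorff_dim_def]] hausdorff_outer_0_mono[of _ K t]
    by (auto intro: less_imp_le)
qed

text \<open>If there were more points, the copies of \<open>K\<close> around them would form a system of similarity dimension
  greater than \<open>hausdorff_dim K\<close>.\<close>

lemma card_separated_le:
  fixes K :: "real set"
  assumes K: "compact K" "K \<noteq> {}" "K \<subseteq> {0..1}" and a: "0 < a" "a \<le> 1"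
    and copies: "\<And>x r. x \<in> K \<Longrightarrow> 0 < r \<Longrightarrow> r \<le> 1 \<Longrightarrow>
      \<exists>\<phi>. \<forall>u\<in>K. \<phi> u \<in> K \<and> dist x (\<phi> u) < r \<and> (\<forall>v\<in>K. a * r * dist u v \<le> dist (\<phi> u) (\<phi> v))"
    and S: "finite S" "S \<subseteq> K" "separated \<rho> S" and \<rho>: "0 < \<rho>" "\<rho> \<le> 1"
  shows "real (card S) \<le> (a * \<rho> / 3) powr (- hausdorff_dim K)"
proof (rule ccontr)
  define s where "s = hausdorff_dim K"
  define b where "b = a * \<rho> / 3"
  assume "\<not> ?thesis"
  then have big: "b powr (- s) < real (card S)" by (simp add: s_def b_def)
  have s: "0 \<le> s" using hausdorff_dim_nonneg[OF K(3)] by (simp add: s_def)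
  have "a * \<rho> \<le> 1" using mult_mono[of a 1 \<rho> 1] a \<rho> by simp
  then have b: "0 < b" "b < 1" using a \<rho> by (auto simp: b_def)
  \<comment> \<open>The assumed excess over a number that is at least 1 gives two points, hence the
    two maps that \<open>no_small_cover\<close> demands.\<close>
  have "1 \<le> b powr (- s)" using b s by (simp add: powr_minus one_le_inverse_iff powr_le1)
  then have c1: "1 < real (card S)" using big by linarith
  \<comment> \<open>The similarity dimension: \<open>card S\<close> copies of ratio b satisfy
    \<open>card S * b powr t = 1\<close>. As \<open>card S\<close> is strictly greater than
    \<open>b powr (- s)\<close>, t is strictly greater than s.\<close>
  define t where "t = - ln (real (card S)) / ln b"
  have lnb: "ln b < 0" using b by simp
  have bt: "b powr t = 1 / real (card S)"
    using b c1 lnb by (simp add: powr_def t_def exp_minus inverse_eq_divide)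
  have "ln (b powr (- s)) < ln (real (card S))"
    using big b c1 by (subst ln_less_cancel_iff) (auto intro: order_less_trans[OF zero_less_one])
  then have "- s * ln b < ln (real (card S))" using b by (simp add: ln_powr)
  then have st: "s < t" using lnb by (simp add: t_def field_simps)
  \<comment> \<open>Radius \<rho> / 3 leaves at least \<rho> / 3 between copies around different
    points of S, and turns the ratio a into b = a * \<rho> / 3.\<close>
  have "\<forall>x\<in>S. \<exists>\<phi>. \<forall>u\<in>K. \<phi> u \<in> K \<and> dist x (\<phi> u) < \<rho> / 3 \<and> (\<forall>v\<in>K. a * (\<rho> / 3) * dist u v \<le> dist (\<phi> u) (\<phi> v))"
    using S \<rho> by (intro ballI copies) auto
  then obtain \<phi> where \<phi>: "\<And>x u. x \<in> S \<Longrightarrow> u \<in> K \<Longrightarrow> \<phi> x u \<in> K \<and> dist x (\<phi> x u) < \<rho> / 3"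
      "\<And>x u v. x \<in> S \<Longrightarrow> u \<in> K \<Longrightarrow> v \<in> K \<Longrightarrow> b * dist u v \<le> dist (\<phi> x u) (\<phi> x v)"
    unfolding bchoice_iff b_def times_divide_eq_right by metis
  have "hausdorff_outer t K \<noteq> 0"
  proof (rule hausdorff_outer_nonzero[OF K(1), of t "(\<rho> / 3) powr t"])
    fix A :: "nat set" and U g
    assume *: "finite A" "K \<subseteq> (\<Union>j\<in>A. U j)" "\<And>j. j \<in> A \<Longrightarrow> 0 \<le> (g j::real)"
      "\<And>j x y. j \<in> A \<Longrightarrow> x \<in> U j \<Longrightarrow> y \<in> U j \<Longrightarrow> dist x y \<le> g j"
    show "(\<rho> / 3) powr t \<le> (\<Sum>j\<in>A. g j powr t)"
    proof (rule no_small_cover[OF K(2) S(1), of \<phi> b "\<rho> / 3" t, OF _ _ _ _ _ _ _ _ *(1,2)])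
      show "\<rho> / 3 \<le> dist (\<phi> x u) (\<phi> y v)" if "x \<in> S" "y \<in> S" "x \<noteq> y" "u \<in> K" "v \<in> K" for x y u v
      proof -
        have "\<rho> \<le> dist x y" using S(3) that by (auto simp: separated_def)
        then show ?thesis
          using \<phi>(1)[of x u] \<phi>(1)[of y v] that
            dist_triangle[of x y "\<phi> x u"] dist_triangle[of "\<phi> x u" y "\<phi> y v"] by (simp add: dist_commute)
      qed
    qed (use * \<phi> b bt c1 s st \<rho> in auto)
  qed (use \<rho> s st in auto)
  then show False using hausdorff_outer_eq_0[OF K(3), of t] st by (simp add: s_def)
qed

section \<open>Expanding Markov maps with bounded distortion\<close>

text \<open>The restriction of the expanding map to the Cantor set; \<open>c x\<close> is the index of the interval
  containing \<open>x\<close>.\<close>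

locale markov_system =
  fixes K :: "real set" and f :: "real \<Rightarrow> real" and c :: "real \<Rightarrow> nat"
    and \<delta> \<gamma> L A \<beta> :: real and m :: nat
  assumes K_unit: "K \<subseteq> {0..1}"
    and f_in: "x \<in> K \<Longrightarrow> f x \<in> K"
    and gap: "0 < \<delta>" "x \<in> K \<Longrightarrow> y \<in> K \<Longrightarrow> c x \<noteq> c y \<Longrightarrow> \<delta> \<le> dist x y"
    and expand: "1 < \<gamma>" "x \<in> K \<Longrightarrow> y \<in> K \<Longrightarrow> c x = c y \<Longrightarrow> \<gamma> * dist x y \<le> dist (f x) (f y)"
    and lip: "0 \<le> L" "x \<in> K \<Longrightarrow> y \<in> K \<Longrightarrow> c x = c y \<Longrightarrow> dist (f x) (f y) \<le> L * dist x y"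
    and distort: "0 \<le> A" "0 < \<beta>" "x \<in> K \<Longrightarrow> y \<in> K \<Longrightarrow> z \<in> K \<Longrightarrow> w \<in> K \<Longrightarrow>
      c y = c x \<Longrightarrow> c z = c x \<Longrightarrow> c w = c x \<Longrightarrow>
      dist x y \<le> D \<Longrightarrow> dist x z \<le> D \<Longrightarrow> dist x w \<le> D \<Longrightarrow>
      dist (f x) (f y) * dist z w \<le> exp (A * D powr \<beta>) * (dist x y * dist (f z) (f w))"
    and markov: "x \<in> K \<Longrightarrow> y \<in> K \<Longrightarrow> c y = c (f x) \<Longrightarrow> \<exists>u\<in>K. c u = c x \<and> f u = y"
    and mixing: "x \<in> K \<Longrightarrow> y \<in> K \<Longrightarrow> \<exists>u\<in>K. c u = c x \<and> (f ^^ m) u = y"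
begin

definition same_itinerary :: "nat \<Rightarrow> real \<Rightarrow> real \<Rightarrow> bool" where
  "same_itinerary n x y \<longleftrightarrow> (\<forall>k<n. c ((f ^^ k) x) = c ((f ^^ k) y))"

lemma same_itinerary_0 [simp]: "same_itinerary 0 x y"
  by (simp add: same_itinerary_def)

lemma same_itinerary_Suc:
  "same_itinerary (Suc n) x y \<longleftrightarrow> c x = c y \<and> same_itinerary n (f x) (f y)"
  unfolding same_itinerary_def All_less_Suc2 by (simp add: funpow_Suc_right del: funpow.simps)

lemma same_itinerary_Suc_last:
  "same_itinerary (Suc n) x y \<longleftrightarrow> same_itinerary n x y \<and> c ((f ^^ n) x) = c ((f ^^ n) y)"
  unfolding same_itinerary_def by (auto simp: less_Suc_eq)

lemma same_itinerary_sym: "same_itinerary n x y \<Longrightarrow> same_itinerary n y x"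
  by (simp add: same_itinerary_def)

lemma same_itinerary_trans: "same_itinerary n x y \<Longrightarrow> same_itinerary n y z \<Longrightarrow> same_itinerary n x z"
  by (simp add: same_itinerary_def)

lemma funpow_in: "x \<in> K \<Longrightarrow> (f ^^ n) x \<in> K"
  by (induction n) (auto intro: f_in)

lemma dist_le_1: "x \<in> K \<Longrightarrow> y \<in> K \<Longrightarrow> dist x y \<le> 1"
  by (drule subsetD[OF K_unit], drule subsetD[OF K_unit]) (auto simp: dist_real_def abs_le_iff)

text \<open>The n-th iterate expands by at least \<open>\<gamma> ^ n\<close> between points that
  agree on n symbols, and K has diameter at most 1.\<close>

lemma dist_le_of_same_itinerary:
  assumes "x \<in> K" "y \<in> K" "same_itinerary n x y"
  shows "dist x y \<le> (1 / \<gamma>) ^ n"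
proof -
  have "\<gamma> ^ n * dist x y \<le> dist ((f ^^ n) x) ((f ^^ n) y)"
    using assms
  proof (induction n arbitrary: x y)
    case (Suc n)
    then have s: "c x = c y" "same_itinerary n (f x) (f y)" by (auto simp: same_itinerary_Suc)
    have "\<gamma> ^ Suc n * dist x y = \<gamma> ^ n * (\<gamma> * dist x y)" by simp
    also have "\<dots> \<le> \<gamma> ^ n * dist (f x) (f y)"
      using expand Suc.prems s by (intro mult_left_mono) auto
    also have "\<dots> \<le> dist ((f ^^ n) (f x)) ((f ^^ n) (f y))"
      using Suc.IH s Suc.prems f_in by blast
    finally show ?case by (simp add: funpow_swap1)
  qed simp
  also have "\<dots> \<le> 1" using assms funpow_in dist_le_1 by blast
  finally show ?thesis using expand(1) by (simp add: field_simps power_divide)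
qed

text \<open>The geometric series of ratio \<open>\<gamma> powr (- \<beta>)\<close>, which bounds the
  exponents accumulated in \<open>bounded_distortion\<close> for every n.\<close>

definition "contraction_sum = 1 / (1 - \<gamma> powr (- \<beta>))"

definition "distortion = exp (A * contraction_sum)"

lemma distortion_ge_1: "1 \<le> distortion"
proof -
  have "\<gamma> powr (- \<beta>) < 1" using expand(1) distort(2) by (simp add: powr_less_one)
  then show ?thesis using distort(1) by (simp add: distortion_def contraction_sum_def)
qed

lemma bounded_distortion:
  assumes K: "x \<in> K" "y \<in> K" "z \<in> K" "w \<in> K"
    and it: "same_itinerary n x y" "same_itinerary n x z" "same_itinerary n x w"
  shows "dist ((f ^^ n) x) ((f ^^ n) y) * dist z w \<le> distortion * (dist x y * dist ((f ^^ n) z) ((f ^^ n) w))"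
proof -
  define q where "q = \<gamma> powr (- \<beta>)"
  have q: "0 < q" "q < 1" using expand(1) distort(2) by (auto simp: q_def powr_less_one)
  have "dist ((f ^^ n) x) ((f ^^ n) y) * dist z w
      \<le> exp (A * (\<Sum>k<n. q ^ Suc k)) * (dist x y * dist ((f ^^ n) z) ((f ^^ n) w))"
    using K it
  proof (induction n arbitrary: x y z w)
    case (Suc n)
    let ?p = "dist x y" and ?p' = "dist (f x) (f y)" and ?p'' = "dist ((f ^^ Suc n) x) ((f ^^ Suc n) y)"
    let ?q = "dist z w" and ?q' = "dist (f z) (f w)" and ?q'' = "dist ((f ^^ Suc n) z) ((f ^^ Suc n) w)"
    let ?E = "exp (A * (\<Sum>k<n. q ^ Suc k))"
    have cc: "c y = c x" "c z = c x" "c w = c x"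
      and it': "same_itinerary n (f x) (f y)" "same_itinerary n (f x) (f z)" "same_itinerary n (f x) (f w)"
      using Suc.prems by (auto simp: same_itinerary_Suc)
    have 1: "?p'' * ?q' \<le> ?E * (?p' * ?q'')"
      using Suc.IH[OF _ _ _ _ it'] Suc.prems f_in by (simp add: funpow_swap1)
    have Dq: "((1 / \<gamma>) ^ Suc n) powr \<beta> = q ^ Suc n"
    proof -
      have "(1 / \<gamma>) ^ Suc n = \<gamma> powr (- real (Suc n))"
        using expand(1) by (simp only: powr_minus powr_realpow) (simp add: power_one_over inverse_eq_divide)
      moreover have "q ^ Suc n = \<gamma> powr (- \<beta> * real (Suc n))"
        using q expand(1) by (simp only: q_def powr_powr flip: powr_realpow)
      ultimately show ?thesis by (simp add: powr_powr algebra_simps)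
    qed
    have D: "dist x y \<le> (1 / \<gamma>) ^ Suc n" "dist x z \<le> (1 / \<gamma>) ^ Suc n" "dist x w \<le> (1 / \<gamma>) ^ Suc n"
      by (rule dist_le_of_same_itinerary; fact Suc.prems)+
    have "?p' * ?q \<le> exp (A * ((1 / \<gamma>) ^ Suc n) powr \<beta>) * (?p * ?q')"
      by (rule distort(3)[OF Suc.prems(1-4) cc D])
    then have 2: "?p' * ?q \<le> exp (A * q ^ Suc n) * (?p * ?q')" by (simp only: Dq)
    \<comment> \<open>The two bounds are multiplied and the intermediate distance \<open>?q'\<close>
      is cancelled; if it vanishes, expansion forces z = w.\<close>
    show ?case
    proof (cases "?q' = 0")
      case True
      have "\<gamma> * ?q \<le> ?q'" using Suc.prems cc by (intro expand(2)) auto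
      then have "\<gamma> * ?q \<le> 0" using True by simp
      then have "?q = 0" using expand(1) by (simp add: mult_le_0_iff)
      then show ?thesis by simp
    next
      case False
      then have q': "0 < ?q'" by (metis zero_le_dist order_le_less)
      have "?p'' * ?q * ?q' = (?p'' * ?q') * ?q" by simp
      also have "\<dots> \<le> ?E * (?p' * ?q'') * ?q" by (intro mult_right_mono 1) auto
      also have "\<dots> = ?E * ?q'' * (?p' * ?q)" by simp
      also have "\<dots> \<le> ?E * ?q'' * (exp (A * q ^ Suc n) * (?p * ?q'))" by (intro mult_left_mono 2) auto
      also have "\<dots> = (?E * exp (A * q ^ Suc n)) * (?p * ?q'') * ?q'" by simp
      also have "?E * exp (A * q ^ Suc n) = exp (A * (\<Sum>k<Suc n. q ^ Suc k))"
        by (simp add: distrib_left flip: exp_add)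
      finally show ?thesis using q' by (simp only: mult_le_cancel_right)
    qed
  qed simp
  also have "\<dots> \<le> distortion * (dist x y * dist ((f ^^ n) z) ((f ^^ n) w))"
  proof (intro mult_right_mono)
    have "(\<Sum>k<n. q ^ Suc k) \<le> (\<Sum>k<n. q ^ k)"
      using q by (intro sum_mono) (simp add: mult_left_le_one_le)
    also have "\<dots> \<le> (\<Sum>k. q ^ k)"
      using q by (intro sum_le_suminf summable_geometric) auto
    also have "\<dots> = 1 / (1 - q)" using q by (simp add: suminf_geometric)
    finally show "exp (A * (\<Sum>k<n. q ^ Suc k)) \<le> distortion"
      unfolding distortion_def contraction_sum_def q_def[symmetric] exp_le_cancel_iff
      using distort(1) by (rule mult_left_mono)
  qed auto
  finally show ?thesis .
qed

text \<open>Iterate until the itineraries of two points of \<open>S\<close> split: then they are \<open>\<delta>\<close> apart, and by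
  bounded distortion all distances in \<open>S\<close> have grown by comparable factors.\<close>

lemma blow_up:
  assumes S: "finite S" "S \<subseteq> K" "separated \<rho> S" "\<And>x y. x \<in> S \<Longrightarrow> y \<in> S \<Longrightarrow> dist x y \<le> R"
    and card: "2 \<le> card S" and \<rho>: "0 < \<rho>"
  obtains T where "finite T" "T \<subseteq> K" "card T = card S" "separated (\<delta> * \<rho> / (distortion * R)) T"
proof -
  have "\<exists>x\<in>S. \<exists>y\<in>S. x \<noteq> y"
  proof (rule ccontr)
    assume "\<not> ?thesis"
    then have "card S \<le> Suc 0" using card_le_Suc0_iff_eq[OF S(1)] by blast
    then show False using card by simp
  qed
  then obtain x0 y0 where xy0: "x0 \<in> S" "y0 \<in> S" "x0 \<noteq> y0" by blast
  define P where "P n \<longleftrightarrow> (\<forall>x\<in>S. \<forall>y\<in>S. same_itinerary n x y)" for n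
  have "\<exists>n. \<not> P n"
  proof -
    have "0 < dist x0 y0" "1 / \<gamma> < 1" using expand(1) xy0 by simp_all
    then obtain n where "(1 / \<gamma>) ^ n < dist x0 y0" using real_arch_pow_inv by blast
    then have "\<not> same_itinerary n x0 y0" using dist_le_of_same_itinerary[of x0 y0 n] xy0 S(2) by fastforce
    then show ?thesis using xy0 by (auto simp: P_def)
  qed
  then have least: "\<not> P (LEAST n. \<not> P n)" by (rule LeastI_ex)
  moreover have "P 0" by (simp add: P_def)
  \<comment> \<open>S agrees on n symbols but not on n + 1, so at time n some pair z, w lies in
    different intervals.\<close>
  ultimately obtain n where n: "(LEAST n. \<not> P n) = Suc n" by (metis not0_implies_Suc)
  have "P n" using not_less_Least[of n "\<lambda>n. \<not> P n"] unfolding n by simp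
  then have same: "same_itinerary n x y" if "x \<in> S" "y \<in> S" for x y using that by (simp add: P_def)
  obtain z w where zw: "z \<in> S" "w \<in> S" "\<not> same_itinerary (Suc n) z w"
    using least[unfolded n] unfolding P_def by blast
  then have "c ((f ^^ n) z) \<noteq> c ((f ^^ n) w)" using same by (simp add: same_itinerary_Suc_last)
  then have far: "\<delta> \<le> dist ((f ^^ n) z) ((f ^^ n) w)" using zw S(2) by (intro gap funpow_in) auto
  have "\<rho> \<le> R" using S(3,4) xy0 by (force simp: separated_def)
  then have R: "0 < R" using \<rho> by simp
  \<comment> \<open>Distortion compares an arbitrary pair with the pair z, w, whose distance grew
    from at most R to at least \<delta>.\<close>
  have grow: "\<delta> * \<rho> / (distortion * R) \<le> dist ((f ^^ n) x) ((f ^^ n) y)" if "x \<in> S" "y \<in> S" "x \<noteq> y" for x y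
  proof -
    have "\<delta> * \<rho> \<le> dist ((f ^^ n) z) ((f ^^ n) w) * dist x y"
      using far S(3) that gap(1) \<rho> by (intro mult_mono) (auto simp: separated_def)
    also have "\<dots> \<le> distortion * (dist z w * dist ((f ^^ n) x) ((f ^^ n) y))"
      using that zw S(2) same by (intro bounded_distortion) auto
    also have "\<dots> \<le> distortion * (R * dist ((f ^^ n) x) ((f ^^ n) y))"
      using S(4) zw distortion_ge_1 by (intro mult_left_mono mult_right_mono) auto
    finally show ?thesis using R distortion_ge_1 by (simp add: field_simps)
  qed
  have pos: "0 < \<delta> * \<rho> / (distortion * R)" using R distortion_ge_1 gap(1) \<rho> by simp
  have "inj_on (f ^^ n) S"
    using grow pos by (intro inj_onI) (metis dist_self not_le)
  then have "card ((f ^^ n) ` S) = card S" by (rule card_image)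
  moreover have "separated (\<delta> * \<rho> / (distortion * R)) ((f ^^ n) ` S)"
    unfolding separated_def by (auto intro!: grow)
  ultimately show ?thesis using that[of "(f ^^ n) ` S"] S funpow_in by blast
qed

text \<open>Inverse branches are composed one symbol at a time through \<open>markov\<close>. The
  symbol of y is the one that x has at time n, which is why the preimage follows x for n + 1
  symbols.\<close>

lemma itinerary_surj:
  assumes "x \<in> K" "y \<in> K" "c y = c ((f ^^ n) x)"
  shows "\<exists>u\<in>K. same_itinerary (Suc n) x u \<and> (f ^^ n) u = y"
  using assms
proof (induction n arbitrary: x)
  case (Suc n)
  have "c y = c ((f ^^ n) (f x))" using Suc.prems by (simp add: funpow_swap1)
  then obtain v where v: "v \<in> K" "same_itinerary (Suc n) (f x) v" "(f ^^ n) v = y"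
    using Suc.IH[of "f x"] Suc.prems f_in by blast
  have "c v = c (f x)" using v(2) by (simp add: same_itinerary_Suc)
  then obtain u where "u \<in> K" "c u = c x" "f u = v" using markov Suc.prems v(1) by blast
  then show ?case using v
    by (intro bexI[of _ u]) (auto simp: same_itinerary_Suc[of "Suc n"] funpow_swap1)
qed (auto simp: same_itinerary_def)

text \<open>A Lipschitz constant on all of K: points in different intervals are at least \<delta>
  apart while their images are at most 1 apart, whence 1 / \<delta>.\<close>

definition "lip_K = max L (1 / \<delta>)"

lemma lip_K: "x \<in> K \<Longrightarrow> y \<in> K \<Longrightarrow> dist (f x) (f y) \<le> lip_K * dist x y"
proof (cases "c x = c y")
  case True
  assume "x \<in> K" "y \<in> K"
  then have "dist (f x) (f y) \<le> L * dist x y" using lip(2) True by blast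
  also have "\<dots> \<le> lip_K * dist x y" by (intro mult_right_mono) (auto simp: lip_K_def)
  finally show ?thesis .
next
  case False
  assume K: "x \<in> K" "y \<in> K"
  have "dist (f x) (f y) \<le> 1" using K f_in dist_le_1 by blast
  also have "\<dots> \<le> 1 / \<delta> * dist x y" using gap K False by (simp add: field_simps)
  also have "\<dots> \<le> lip_K * dist x y" by (intro mult_right_mono) (auto simp: lip_K_def)
  finally show ?thesis .
qed

lemma lip_K_pos: "0 < lip_K"
  using gap(1) by (simp add: lip_K_def less_max_iff_disj)

lemma lip_K_funpow: "x \<in> K \<Longrightarrow> y \<in> K \<Longrightarrow> dist ((f ^^ n) x) ((f ^^ n) y) \<le> lip_K ^ n * dist x y"
proof (induction n)
  case (Suc n)
  have "dist ((f ^^ Suc n) x) ((f ^^ Suc n) y) \<le> lip_K * dist ((f ^^ n) x) ((f ^^ n) y)"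
    using Suc.prems by (simp add: lip_K funpow_in)
  also have "\<dots> \<le> lip_K * (lip_K ^ n * dist x y)"
    using Suc lip_K_pos by (intro mult_left_mono) auto
  finally show ?case by (simp add: mult.assoc)
qed simp

text \<open>A copy is mapped onto K by the iterate m + n: the first n steps are controlled by
  \<open>distortion\<close>, the m mixing steps by \<open>lip_K ^ m\<close>. The cap at 1 serves the
  case in which the copy is K itself.\<close>

definition "copy_ratio = min 1 (1 / (distortion * lip_K ^ m))"

lemma copy_ratio: "0 < copy_ratio" "copy_ratio \<le> 1"
  using distortion_ge_1 lip_K_pos by (auto simp: copy_ratio_def)

text \<open>The inverse branch of a suitable iterate carries \<open>K\<close> into the largest cylinder around \<open>x\<close>
  that is contained in the ball.\<close>

lemma copies:
  assumes x: "x \<in> K" and r: "0 < r" "r \<le> 1"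
  shows "\<exists>\<phi>. \<forall>u\<in>K. \<phi> u \<in> K \<and> dist x (\<phi> u) < r \<and> (\<forall>v\<in>K. copy_ratio * r * dist u v \<le> dist (\<phi> u) (\<phi> v))"
proof -
  define P where "P n \<longleftrightarrow> (\<forall>y\<in>K. same_itinerary n x y \<longrightarrow> dist x y < r)" for n
  have "\<exists>n. P n"
  proof -
    have "1 / \<gamma> < 1" using expand(1) by simp
    then obtain n where "(1 / \<gamma>) ^ n < r" using real_arch_pow_inv r(1) by blast
    then have "P n" using dist_le_of_same_itinerary[OF x] by (fastforce simp: P_def)
    then show ?thesis by blast
  qed
  then have PN: "P (LEAST n. P n)" by (rule LeastI_ex)
  show ?thesis
  proof (cases "LEAST n. P n")
    case 0
    have "P 0" using PN 0 by (simp only:)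
    then have "dist x u < r" if "u \<in> K" for u using that by (simp add: P_def)
    moreover have "copy_ratio * r * dist u v \<le> dist u v" for u v :: real
      using copy_ratio r mult_mono[of copy_ratio 1 r 1] by (intro mult_left_le_one_le) auto
    ultimately show ?thesis by (intro exI[of _ "\<lambda>u. u"]) auto
  next
    case (Suc n)
    have "P (Suc n)" using PN Suc by (simp only:)
    have "\<not> P n" by (rule not_less_Least) (simp only: Suc lessI)
    \<comment> \<open>Minimality gives the lower bound on size: the cylinder one level up reaches
      distance at least r from x.\<close>
    then obtain y where y: "y \<in> K" "same_itinerary n x y" "r \<le> dist x y" by (auto simp: P_def)
    have "\<exists>v\<in>K. same_itinerary (Suc n) x v \<and> (f ^^ (m + n)) v = u" if u: "u \<in> K" for u
    proof -
      \<comment> \<open>Mixing starts from the interval of the n-th image of x, so w can be pulled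
        back along the itinerary of x.\<close>
      obtain w where w: "w \<in> K" "c w = c ((f ^^ n) x)" "(f ^^ m) w = u"
        using mixing[OF funpow_in[OF x] u] by blast
      then obtain v where "v \<in> K" "same_itinerary (Suc n) x v" "(f ^^ n) v = w"
        using itinerary_surj[OF x] by blast
      then show ?thesis using w by (intro bexI[of _ v]) (auto simp: funpow_add)
    qed
    then obtain \<phi> where \<phi>: "\<And>u. u \<in> K \<Longrightarrow> \<phi> u \<in> K" "\<And>u. u \<in> K \<Longrightarrow> same_itinerary (Suc n) x (\<phi> u)"
        "\<And>u. u \<in> K \<Longrightarrow> (f ^^ (m + n)) (\<phi> u) = u"
      by metis
    have "copy_ratio * r * dist u v \<le> dist (\<phi> u) (\<phi> v)" if uv: "u \<in> K" "v \<in> K" for u v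
    proof -
      let ?u = "(f ^^ n) (\<phi> u)" and ?v = "(f ^^ n) (\<phi> v)"
      have it: "same_itinerary n x (\<phi> u)" "same_itinerary n x (\<phi> v)"
        using \<phi>(2) uv by (auto simp: same_itinerary_Suc_last)
      \<comment> \<open>In n steps the pair x, y grows from at least r to at most 1; distortion
        transfers this rate to the pair in the copy.\<close>
      have "dist ?u ?v * dist x y \<le> distortion * (dist (\<phi> u) (\<phi> v) * dist ((f ^^ n) x) ((f ^^ n) y))"
        using it y x \<phi>(1) uv
        by (intro bounded_distortion) (auto intro: same_itinerary_sym same_itinerary_trans)
      also have "\<dots> \<le> distortion * (dist (\<phi> u) (\<phi> v) * 1)"
        using distortion_ge_1 x y by (intro mult_left_mono dist_le_1 funpow_in) auto
      finally have 1: "dist ?u ?v * dist x y \<le> distortion * dist (\<phi> u) (\<phi> v)" by simp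
      have "dist u v = dist ((f ^^ m) ?u) ((f ^^ m) ?v)"
        using \<phi>(3)[OF uv(1)] \<phi>(3)[OF uv(2)] by (simp add: funpow_add)
      also have "\<dots> \<le> lip_K ^ m * dist ?u ?v" using \<phi>(1) uv by (intro lip_K_funpow funpow_in) auto
      finally have "r * dist u v \<le> r * (lip_K ^ m * dist ?u ?v)" using r by (intro mult_left_mono) auto
      also have "\<dots> \<le> dist x y * (lip_K ^ m * dist ?u ?v)"
        using y lip_K_pos by (intro mult_right_mono) auto
      also have "\<dots> = lip_K ^ m * (dist ?u ?v * dist x y)" by simp
      also have "\<dots> \<le> lip_K ^ m * (distortion * dist (\<phi> u) (\<phi> v))"
        using lip_K_pos by (intro mult_left_mono 1) auto
      finally have 2: "r * dist u v \<le> (distortion * lip_K ^ m) * dist (\<phi> u) (\<phi> v)" by (simp add: mult.assoc mult.left_commute)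
      have "copy_ratio * r * dist u v \<le> 1 / (distortion * lip_K ^ m) * (r * dist u v)"
        unfolding mult.assoc using r by (intro mult_right_mono) (auto simp: copy_ratio_def)
      also have "\<dots> \<le> dist (\<phi> u) (\<phi> v)"
        using 2 distortion_ge_1 lip_K_pos by (simp add: field_simps)
      finally show ?thesis .
    qed
    moreover have "dist x (\<phi> u) < r" if "u \<in> K" for u
      using \<open>P (Suc n)\<close> \<phi>(1,2) that by (simp add: P_def)
    ultimately show ?thesis using \<phi>(1) by blast
  qed
qed

end

section \<open>Counting separated points of regular Cantor sets\<close>

text \<open>The counting condition in the definition of the Assouad dimension.\<close>

definition assouad_bound :: "real \<Rightarrow> real \<Rightarrow> 'a::metric_space set \<Rightarrow> bool" where
  "assouad_bound C s K \<longleftrightarrow> (\<forall>S \<rho> R. finite S \<longrightarrow> S \<subseteq> K \<longrightarrow> separated \<rho> S \<longrightarrow> 0 < \<rho> \<longrightarrow> \<rho> \<le> R \<longrightarrow>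
     (\<forall>x\<in>S. \<forall>y\<in>S. dist x y \<le> R) \<longrightarrow> real (card S) \<le> C * (R / \<rho>) powr s)"

lemma assouad_boundD:
  assumes "assouad_bound C s K" "finite S" "S \<subseteq> K" "separated \<rho> S" "0 < \<rho>" "\<rho> \<le> R"
    and "\<And>x y. x \<in> S \<Longrightarrow> y \<in> S \<Longrightarrow> dist x y \<le> R"
  shows "real (card S) \<le> C * (R / \<rho>) powr s"
  using assms unfolding assouad_bound_def by simp

text \<open>\<open>blow_up\<close> moves S to unit size with separation of order \<rho> / R, where
  \<open>card_separated_le\<close> counts; b collects the constants of both. The
  \<open>max 1\<close> in C serves sets with at most one point.\<close>

lemma (in markov_system) assouad_bound_hausdorff_dim:
  assumes "compact K" "K \<noteq> {}"
  obtains C where "0 \<le> C" "assouad_bound C (hausdorff_dim K) K"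
proof -
  define s where "s = hausdorff_dim K"
  have s: "0 \<le> s" using hausdorff_dim_nonneg[OF K_unit] by (simp add: s_def)
  define b where "b = copy_ratio * \<delta> / (3 * distortion)"
  have b: "0 < b" using copy_ratio gap(1) distortion_ge_1 by (simp add: b_def)
  define C where "C = max 1 (b powr (- s))"
  have main: "real (card S) \<le> C * (R / \<rho>) powr s"
    if S: "finite S" "S \<subseteq> K" "separated \<rho> S" "\<And>x y. x \<in> S \<Longrightarrow> y \<in> S \<Longrightarrow> dist x y \<le> R"
      and \<rho>: "0 < \<rho>" "\<rho> \<le> R" for S \<rho> R
  proof (cases "card S \<le> 1")
    case True
    have "1 * 1 \<le> C * (R / \<rho>) powr s"
      using \<rho> s by (intro mult_mono ge_one_powr_ge_zero) (auto simp: C_def)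
    then show ?thesis using True by simp
  next
    case False
    then have "2 \<le> card S" by simp
    then obtain T where T: "finite T" "T \<subseteq> K" "card T = card S"
        "separated (\<delta> * \<rho> / (distortion * R)) T"
      using blow_up[OF S _ \<rho>(1)] by blast
    have "\<not> card T \<le> Suc 0" using False T(3) by simp
    then obtain x y where "x \<in> T" "y \<in> T" "x \<noteq> y" using card_le_Suc0_iff_eq[OF T(1)] by blast
    \<comment> \<open>Distinct points of K are at most 1 apart, so the new separation is a scale
      that \<open>card_separated_le\<close> admits.\<close>
    then have "\<delta> * \<rho> / (distortion * R) \<le> 1"
      using T(2,4) dist_le_1[of x y] by (force simp: separated_def)
    moreover have "0 < \<delta> * \<rho> / (distortion * R)" using \<rho> gap(1) distortion_ge_1 by simp
    ultimately have "real (card T) \<le> (copy_ratio * (\<delta> * \<rho> / (distortion * R)) / 3) powr (- s)"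
      unfolding s_def using T(1,2,4) copy_ratio copies
      by (intro card_separated_le[OF assms K_unit]) auto
    also have "copy_ratio * (\<delta> * \<rho> / (distortion * R)) / 3 = b / (R / \<rho>)"
      by (simp add: b_def)
    also have "(b / (R / \<rho>)) powr (- s) = b powr (- s) * (R / \<rho>) powr s"
      using b \<rho> by (simp only: powr_divide[of b "R / \<rho>"] powr_minus) (simp add: field_simps)
    also have "\<dots> \<le> C * (R / \<rho>) powr s"
      by (intro mult_right_mono) (auto simp: C_def)
    finally show ?thesis using T(3) by simp
  qed
  have "assouad_bound C s K"
    unfolding assouad_bound_def by (intro allI impI main) auto
  then show ?thesis
    by (intro that[of C]) (simp_all add: C_def s_def)
qed

section \<open>From the regularity of the expanding map to the symbolic system\<close>

lemma continuous_on_hoelder: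
  fixes g :: "real \<Rightarrow> real"
  assumes "0 < \<beta>" "\<And>x y. x \<in> V \<Longrightarrow> y \<in> V \<Longrightarrow> \<bar>g x - g y\<bar> \<le> C * \<bar>x - y\<bar> powr \<beta>"
  shows "continuous_on V g"
  unfolding continuous_on_def
proof
  fix x assume x: "x \<in> V"
  have "((\<lambda>y. C * \<bar>y - x\<bar> powr \<beta>) \<longlongrightarrow> C * \<bar>x - x\<bar> powr \<beta>) (at x within V)"
    using assms(1) by (intro tendsto_powr' tendsto_intros) auto
  then have "((\<lambda>y. C * \<bar>y - x\<bar> powr \<beta>) \<longlongrightarrow> 0) (at x within V)" by simp
  moreover have "\<forall>\<^sub>F y in at x within V. norm (g y - g x) \<le> C * \<bar>y - x\<bar> powr \<beta>"
    using assms(2) x by (auto simp: eventually_at_filter)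
  ultimately have "((\<lambda>y. g y - g x) \<longlongrightarrow> 0) (at x within V)"
    by (rule Lim_null_comparison[rotated])
  then show "(g \<longlongrightarrow> g x) (at x within V)" using LIM_zero_cancel by blast
qed

text \<open>For \<alpha> \<le> 1 the top derivative is the first, and its Hoelder bound is given.
  For larger \<alpha> the second derivative is continuous, hence bounded on X, and the mean value
  theorem gives exponent 1; the segment between the points must then lie in X, hence the intervals
  \<open>{a..b}\<close>.\<close>

lemma C_class_deriv:
  assumes V: "C_class (1 + \<alpha>) V \<psi>" "\<alpha> > 0" "open V"
  shows "\<And>x. x \<in> V \<Longrightarrow> (\<psi> has_real_derivative deriv \<psi> x) (at x)"
    and "continuous_on V (deriv \<psi>)"
    and "\<And>X. compact X \<Longrightarrow> X \<subseteq> V \<Longrightarrow> \<exists>H\<ge>0. \<exists>\<beta>>0. \<forall>a b. {a..b} \<subseteq> X \<longrightarrow>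
      (\<forall>x\<in>{a..b}. \<forall>y\<in>{a..b}. \<bar>deriv \<psi> x - deriv \<psi> y\<bar> \<le> H * \<bar>x - y\<bar> powr \<beta>)"
proof -
  define k where "k = nat (\<lceil>1 + \<alpha>\<rceil> - 1)"
  define \<beta> where "\<beta> = 1 + \<alpha> - real k"
  have k1: "1 \<le> k" and \<beta>: "0 < \<beta>" using V(2) unfolding k_def \<beta>_def by linarith+
  have diff: "(deriv ^^ j) \<psi> field_differentiable (at x)" if "j < k" "x \<in> V" for j x
    using V(1) that by (auto simp: C_class_def k_def Let_def)
  obtain C where C: "\<And>x y. x \<in> V \<Longrightarrow> y \<in> V \<Longrightarrow> \<bar>(deriv ^^ k) \<psi> x - (deriv ^^ k) \<psi> y\<bar> \<le> C * \<bar>x - y\<bar> powr \<beta>"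
    using V(1) unfolding C_class_def Let_def k_def[symmetric] \<beta>_def[symmetric] by blast
  have D: "((deriv ^^ j) \<psi> has_real_derivative (deriv ^^ Suc j) \<psi> x) (at x)" if "j < k" "x \<in> V" for j x
    using diff[OF that] by (simp add: DERIV_deriv_iff_field_differentiable)
  have cont: "continuous_on V ((deriv ^^ j) \<psi>)" if "j \<le> k" for j
  proof (cases "j = k")
    case True
    then show ?thesis using continuous_on_hoelder[OF \<beta> C] by simp
  next
    case False
    then show ?thesis using D[of j] that
      by (intro DERIV_continuous_on[where D = "(deriv ^^ Suc j) \<psi>"]) (auto intro: has_field_derivative_at_within)
  qed
  show "(\<psi> has_real_derivative deriv \<psi> x) (at x)" if "x \<in> V" for x
    using D[of 0 x] k1 that by simp
  show "continuous_on V (deriv \<psi>)" using cont[of 1] k1 by simp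
  show "\<exists>H\<ge>0. \<exists>\<beta>>0. \<forall>a b. {a..b} \<subseteq> X \<longrightarrow>
      (\<forall>x\<in>{a..b}. \<forall>y\<in>{a..b}. \<bar>deriv \<psi> x - deriv \<psi> y\<bar> \<le> H * \<bar>x - y\<bar> powr \<beta>)"
    if X: "compact X" "X \<subseteq> V" for X
  proof (cases "k = 1")
    case True
    have "\<bar>deriv \<psi> x - deriv \<psi> y\<bar> \<le> max C 0 * \<bar>x - y\<bar> powr \<beta>" if "x \<in> X" "y \<in> X" for x y
    proof -
      have "\<bar>deriv \<psi> x - deriv \<psi> y\<bar> \<le> C * \<bar>x - y\<bar> powr \<beta>"
        using C[of x y] that X True by auto
      also have "\<dots> \<le> max C 0 * \<bar>x - y\<bar> powr \<beta>" by (intro mult_right_mono) auto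
      finally show ?thesis .
    qed
    then show ?thesis using \<beta> by (intro exI[of _ "max C 0"] conjI exI[of _ \<beta>]) auto
  next
    case False
    then have k2: "2 \<le> k" using k1 by simp
    have "continuous_on X ((deriv ^^ 2) \<psi>)" using cont[OF k2] X(2) by (rule continuous_on_subset)
    then have "bounded ((deriv ^^ 2) \<psi> ` X)"
      using X(1) by (intro compact_imp_bounded compact_continuous_image)
    then obtain H where H: "0 < H" "\<And>x. x \<in> X \<Longrightarrow> \<bar>(deriv ^^ 2) \<psi> x\<bar> \<le> H"
      by (auto simp: bounded_pos)
    have "\<bar>deriv \<psi> x - deriv \<psi> y\<bar> \<le> H * \<bar>x - y\<bar> powr 1" if ab: "{a..b} \<subseteq> X" "x \<in> {a..b}" "y \<in> {a..b}" for a b x y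
    proof -
      have "norm (deriv \<psi> x - deriv \<psi> y) \<le> H * norm (x - y)"
      proof (rule field_differentiable_bound[where S = "{a..b}" and f' = "(deriv ^^ 2) \<psi>"])
        fix z assume z: "z \<in> {a..b}"
        then have "z \<in> V" using ab X by auto
        then show "(deriv \<psi> has_field_derivative (deriv ^^ 2) \<psi> z) (at z within {a..b})"
          using D[of 1 z] k2 by (auto simp: numeral_2_eq_2 intro: has_field_derivative_at_within)
        show "norm ((deriv ^^ 2) \<psi> z) \<le> H" using H z ab by auto
      qed (use ab in auto)
      then show ?thesis by simp
    qed
    then show ?thesis using H(1) by (intro exI[of _ H] conjI exI[of _ 1]) auto
  qed
qed

text \<open>An interval that misses X but meets its hull sits in a gap with points of X on both
  sides. For X a union of the \<open>I j\<close> this is the Markov property: if the image of one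
  interval meets another, it covers it.\<close>

lemma convex_hull_disjoint_interval:
  fixes X :: "real set"
  assumes p: "p \<in> convex hull X" "p \<in> {a..b}" and y: "y \<in> {a..b}" and dis: "X \<inter> {a..b} = {} \<or> {a..b} \<subseteq> X"
  shows "y \<in> convex hull X"
proof (cases "{a..b} \<subseteq> X")
  case True
  then show ?thesis using y hull_subset[of X convex] by blast
next
  case False
  then have dis: "X \<inter> {a..b} = {}" using dis by blast
  have "\<exists>u\<in>X. u \<le> p"
  proof (rule ccontr)
    assume "\<not> ?thesis"
    then have "convex hull X \<subseteq> {p<..}" by (intro hull_minimal) auto
    then show False using p(1) by auto
  qed
  moreover have "\<exists>v\<in>X. p \<le> v"
  proof (rule ccontr)
    assume "\<not> ?thesis"
    then have "convex hull X \<subseteq> {..<p}" by (intro hull_minimal) auto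
    then show False using p(1) by auto
  qed
  ultimately obtain u v where uv: "u \<in> X" "v \<in> X" "u \<le> p" "p \<le> v" by blast
  have "u \<notin> {a..b}" "v \<notin> {a..b}" using uv dis by auto
  then have "u \<le> y" "y \<le> v" using uv p(2) y by auto
  moreover have "closed_segment u v \<subseteq> convex hull X"
    using uv by (intro closed_segment_subset_convex_hull hull_inc)
  ultimately show ?thesis by (auto simp: closed_segment_eq_real_ivl)
qed

lemma finite_disjoint_compact_gap:
  fixes I :: "nat \<Rightarrow> 'a::heine_borel set"
  assumes "\<And>i. i < r \<Longrightarrow> compact (I i)" "disjoint_family_on I {..<r}"
  obtains \<delta> where "0 < \<delta>" "\<And>i j x y. i < r \<Longrightarrow> j < r \<Longrightarrow> i \<noteq> j \<Longrightarrow> x \<in> I i \<Longrightarrow> y \<in> I j \<Longrightarrow> \<delta> \<le> dist x y"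
proof -
  have "\<exists>d>0. \<forall>x\<in>I i. \<forall>y\<in>I j. d \<le> dist x y" if "i < r" "j < r" "i \<noteq> j" for i j
    using assms(2) that
    by (intro separate_compact_closed assms(1) compact_imp_closed) (auto simp: disjoint_family_on_def)
  then obtain d where d: "\<And>i j. i < r \<Longrightarrow> j < r \<Longrightarrow> i \<noteq> j \<Longrightarrow> 0 < d i j \<and> (\<forall>x\<in>I i. \<forall>y\<in>I j. d i j \<le> dist x y)"
    by metis
  define P where "P = {(i, j). i < r \<and> j < r \<and> i \<noteq> j}"
  have "P \<subseteq> {..<r} \<times> {..<r}" by (auto simp: P_def)
  then have fin: "finite P" by (rule finite_subset) auto
  \<comment> \<open>The entry 1 keeps the minimum over a nonempty set when there is no pair of
    distinct indices.\<close>
  define \<delta> where "\<delta> = Min (insert 1 ((\<lambda>(i, j). d i j) ` P))"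
  have "0 < \<delta>" unfolding \<delta>_def using fin d by (subst Min_gr_iff) (auto simp: P_def)
  moreover have "\<delta> \<le> dist x y" if "i < r" "j < r" "i \<noteq> j" "x \<in> I i" "y \<in> I j" for i j x y
  proof -
    have "(i, j) \<in> P" using that by (simp add: P_def)
    then have "\<delta> \<le> d i j" unfolding \<delta>_def using fin by (intro Min_le) force+
    then show ?thesis using d[OF that(1-3)] that(4,5) by force
  qed
  ultimately show ?thesis by (rule that)
qed

text \<open>By compactness |deriv \<psi>| attains its minimum and maximum on the union of the
  intervals; they serve as \<gamma> > 1 and L. Distortion comes from the Hoelder bound and the mean
  value theorem.\<close>

lemma regular_cantor_set_markov_system:
  assumes "regular_cantor_set \<alpha> K" "\<alpha> > 0"
  obtains f c \<delta> \<gamma> L A \<beta> m where "compact K" "K \<noteq> {}" "markov_system K f c \<delta> \<gamma> L A \<beta> m"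
proof -
  from assms(1) obtain r :: nat and I :: "nat \<Rightarrow> real set" and \<psi> V where
    r: "1 \<le> r" and I: "\<forall>i<r. \<exists>a b. a < b \<and> I i = {a..b} \<and> I i \<subseteq> {0..1}"
    and disj: "disjoint_family_on I {..<r}" and KI: "K \<subseteq> (\<Union>i<r. I i)"
    and fr: "\<forall>i<r. frontier (I i) \<subseteq> K" and V: "open V" "(\<Union>i<r. I i) \<subseteq> V"
    and smooth: "C_class (1 + \<alpha>) V \<psi>" and exp: "\<forall>x\<in>V. 1 < \<bar>deriv \<psi> x\<bar>"
    and hull: "\<forall>i<r. \<exists>J\<subseteq>{..<r}. \<psi> ` I i = convex hull (\<Union>j\<in>J. I j)"
    and mix: "\<forall>i<r. \<forall>\<^sub>F n in sequentially. (\<psi> ^^ n) ` (K \<inter> I i) = K"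
    and K: "K = (\<Inter>n. (\<psi> ^^ n) -` (\<Union>i<r. I i))"
    unfolding regular_cantor_set_def by blast
  define U where "U = (\<Union>i<r. I i)"
  have cI: "compact (I i)" if "i < r" for i using I that by (metis compact_Icc)
  have U: "compact U" unfolding U_def using cI by (intro compact_UN) auto
  have UV: "U \<subseteq> V" using V(2) by (simp add: U_def)
  note D = C_class_deriv(1)[OF smooth \<open>\<alpha> > 0\<close> V(1)]
  have contD: "continuous_on U (deriv \<psi>)"
    using C_class_deriv(2)[OF smooth \<open>\<alpha> > 0\<close> V(1)] UV by (rule continuous_on_subset)
  have cont: "continuous_on U \<psi>"
    using D UV by (intro DERIV_continuous_on[where D = "deriv \<psi>"]) (auto intro: has_field_derivative_at_within)
  obtain H \<beta> where H: "0 \<le> H" "0 < \<beta>" and hoelder: "\<And>a b x y. {a..b} \<subseteq> U \<Longrightarrow> x \<in> {a..b} \<Longrightarrow> y \<in> {a..b} \<Longrightarrow>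
      \<bar>deriv \<psi> x - deriv \<psi> y\<bar> \<le> H * \<bar>x - y\<bar> powr \<beta>"
    using C_class_deriv(3)[OF smooth \<open>\<alpha> > 0\<close> V(1) U UV] by blast
  have hoelder': "\<bar>deriv \<psi> x - deriv \<psi> y\<bar> \<le> H * \<bar>x - y\<bar> powr \<beta>" if i: "i < r" "x \<in> I i" "y \<in> I i" for i x y
  proof -
    obtain a b where "I i = {a..b}" using I i by blast
    moreover have "I i \<subseteq> U" using i by (auto simp: U_def)
    ultimately show ?thesis using hoelder i by metis
  qed
  \<comment> \<open>The location of the intermediate point, within \<open>dist x y\<close> of x, is
    what the distortion estimate relies on.\<close>
  have mvt: "\<exists>\<xi>\<in>I i. dist \<xi> x \<le> dist x y \<and> dist (\<psi> x) (\<psi> y) = \<bar>deriv \<psi> \<xi>\<bar> * dist x y"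
    if i: "i < r" and xy: "x \<in> I i" "y \<in> I i" for i x y
  proof -
    have mvt': "\<exists>\<xi>\<in>I i. x \<le> \<xi> \<and> \<xi> \<le> y \<and> \<psi> y - \<psi> x = (y - x) * deriv \<psi> \<xi>" if "x < y" "x \<in> I i" "y \<in> I i" for x y
    proof -
      obtain a b where ab: "I i = {a..b}" using I i by blast
      have sub: "z \<in> V" if "x \<le> z" "z \<le> y" for z
      proof -
        have "z \<in> I i" using ab \<open>x \<in> I i\<close> \<open>y \<in> I i\<close> that by auto
        then show ?thesis using V(2) i by blast
      qed
      obtain z where "x < z" "z < y" "\<psi> y - \<psi> x = (y - x) * deriv \<psi> z"
        using MVT2[OF \<open>x < y\<close>, of \<psi> "deriv \<psi>"] D sub by blast
      then show ?thesis using ab that by (intro bexI[of _ z]) auto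
    qed
    consider "x < y" | "x = y" | "y < x" by linarith
    then show ?thesis
    proof cases
      case 1
      from mvt'[OF this xy] obtain \<xi> where "\<xi> \<in> I i" "x \<le> \<xi>" "\<xi> \<le> y" "\<psi> y - \<psi> x = (y - x) * deriv \<psi> \<xi>" by blast
      then show ?thesis
        by (intro bexI[of _ \<xi>]) (auto simp: dist_real_def abs_mult abs_minus_commute[of "\<psi> x"])
    next
      case 2
      then show ?thesis using xy by (intro bexI[of _ x]) auto
    next
      case 3
      from mvt'[OF this xy(2,1)] obtain \<xi> where "\<xi> \<in> I i" "y \<le> \<xi>" "\<xi> \<le> x" "\<psi> x - \<psi> y = (x - y) * deriv \<psi> \<xi>" by blast
      then show ?thesis by (intro bexI[of _ \<xi>]) (auto simp: dist_real_def abs_mult)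
    qed
  qed
  have Kne: "K \<noteq> {}" and Une: "U \<noteq> {}"
  proof -
    obtain a b where ab: "a < b" "I 0 = {a..b}" using I r by (metis less_eq_Suc_le One_nat_def)
    then have "a \<in> frontier (I 0)" by (simp add: frontier_def)
    then show "K \<noteq> {}" using fr r by (metis One_nat_def Suc_le_eq empty_iff subsetD)
    show "U \<noteq> {}" using ab r by (force simp: U_def)
  qed
  have absD: "continuous_on U (\<lambda>x. \<bar>deriv \<psi> x\<bar>)" using contD by (intro continuous_intros)
  obtain x0 where x0: "x0 \<in> U" "\<And>x. x \<in> U \<Longrightarrow> \<bar>deriv \<psi> x0\<bar> \<le> \<bar>deriv \<psi> x\<bar>"
    using continuous_attains_inf[OF U Une absD] by blast
  obtain x1 where x1: "x1 \<in> U" "\<And>x. x \<in> U \<Longrightarrow> \<bar>deriv \<psi> x\<bar> \<le> \<bar>deriv \<psi> x1\<bar>"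
    using continuous_attains_sup[OF U Une absD] by blast
  obtain \<delta> where \<delta>: "0 < \<delta>" "\<And>i j x y. i < r \<Longrightarrow> j < r \<Longrightarrow> i \<noteq> j \<Longrightarrow> x \<in> I i \<Longrightarrow> y \<in> I j \<Longrightarrow> \<delta> \<le> dist x y"
    using finite_disjoint_compact_gap[OF cI disj] by blast
  have K_iff: "x \<in> K \<longleftrightarrow> (\<forall>n. (\<psi> ^^ n) x \<in> U)" for x
    using K by (auto simp: U_def)
  define c where "c x = (SOME i. i < r \<and> x \<in> I i)" for x
  have c: "c x < r" "x \<in> I (c x)" if "x \<in> U" for x
    using that someI_ex[of "\<lambda>i. i < r \<and> x \<in> I i"] by (auto simp: U_def c_def)
  have c_eq: "c x = i" if "i < r" "x \<in> I i" for i x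
  proof -
    have "x \<in> U" using that by (auto simp: U_def)
    then show ?thesis using c[of x] disj that by (fastforce simp: disjoint_family_on_def)
  qed
  have KU: "x \<in> U" if "x \<in> K" for x using K_iff[of x] that by (metis funpow_0)
  have cK: "c x < r" "x \<in> I (c x)" if "x \<in> K" for x
    using c[OF KU[OF that]] by blast+
  have IU: "x \<in> U" if "i < r" "x \<in> I i" for x i using that by (auto simp: U_def)
  have K_Suc: "x \<in> K \<longleftrightarrow> x \<in> U \<and> \<psi> x \<in> K" for x
  proof (intro iffI conjI)
    assume x: "x \<in> K"
    then show "x \<in> U" by (rule KU)
    have "(\<psi> ^^ n) (\<psi> x) \<in> U" for n
      using K_iff[THEN iffD1, OF x, rule_format, of "Suc n"] by (simp add: funpow_swap1)
    then show "\<psi> x \<in> K" by (simp add: K_iff)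
  next
    assume x: "x \<in> U \<and> \<psi> x \<in> K"
    have "(\<psi> ^^ n) x \<in> U" for n
    proof (cases n)
      case (Suc k)
      then show ?thesis using x K_iff[of "\<psi> x"] by (simp add: funpow_swap1)
    qed (use x in simp)
    then show "x \<in> K" by (simp add: K_iff)
  qed
  \<comment> \<open>Finitely many intervals share one mixing time.\<close>
  obtain m where m: "\<And>i. i < r \<Longrightarrow> (\<psi> ^^ m) ` (K \<inter> I i) = K"
  proof -
    have "\<forall>\<^sub>F n in sequentially. \<forall>i\<in>{..<r}. (\<psi> ^^ n) ` (K \<inter> I i) = K"
      using mix by (intro eventually_ball_finite) auto
    then show ?thesis using that eventually_happens by fastforce
  qed
  have closed_K: "closed K"
  proof -
    \<comment> \<open>Continuity of \<psi> is guaranteed only near U, so preimages are taken one at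
      a time inside U.\<close>
    define T where "T n = {x. \<forall>j\<le>n. (\<psi> ^^ j) x \<in> U}" for n
    have "closed (T n)" for n
    proof (induction n)
      case 0
      then show ?case using U by (simp add: T_def compact_imp_closed)
    next
      case (Suc n)
      have "T (Suc n) = U \<inter> \<psi> -` T n"
      proof -
        have "(\<forall>j\<le>Suc n. (\<psi> ^^ j) x \<in> U) \<longleftrightarrow> x \<in> U \<and> (\<forall>j\<le>n. (\<psi> ^^ j) (\<psi> x) \<in> U)" for x
          unfolding less_Suc_eq_le[symmetric] All_less_Suc2 by (simp add: funpow_swap1)
        then show ?thesis by (auto simp: T_def)
      qed
      then show ?case
        using continuous_closed_preimage[OF cont compact_imp_closed[OF U] Suc] by simp
    qed
    moreover have "K = (\<Inter>n. T n)" using K_iff by (auto simp: T_def)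
    ultimately show ?thesis by (metis closed_INT)
  qed
  have U01: "U \<subseteq> {0..1}" using I by (fastforce simp: U_def)
  have KU': "K \<subseteq> U" using KU by blast
  have compact_K: "compact K"
    using compact_Int_closed[OF U closed_K] KU' by (simp add: Int_absorb1)
  have "markov_system K \<psi> c \<delta> \<bar>deriv \<psi> x0\<bar> \<bar>deriv \<psi> x1\<bar> (H * 4 powr \<beta>) \<beta> m"
  proof
    show "K \<subseteq> {0..1}" using KU' U01 by blast
    show "\<psi> x \<in> K" if "x \<in> K" for x using that K_Suc by blast
    show "0 < \<delta>" by fact
    show "\<delta> \<le> dist x y" if "x \<in> K" "y \<in> K" "c x \<noteq> c y" for x y
      by (rule \<delta>(2)[OF cK(1)[OF that(1)] cK(1)[OF that(2)] that(3) cK(2)[OF that(1)] cK(2)[OF that(2)]])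
    show "1 < \<bar>deriv \<psi> x0\<bar>" using exp x0(1) UV by blast
    show "\<bar>deriv \<psi> x0\<bar> * dist x y \<le> dist (\<psi> x) (\<psi> y)" if xy: "x \<in> K" "y \<in> K" "c x = c y" for x y
    proof -
      obtain \<xi> where "\<xi> \<in> I (c x)" "dist (\<psi> x) (\<psi> y) = \<bar>deriv \<psi> \<xi>\<bar> * dist x y"
        using mvt[OF cK[OF xy(1)] cK(2)[OF xy(2), folded xy(3)]] by blast
      then show ?thesis using x0(2)[of \<xi>] IU[OF cK(1)[OF xy(1)]] by (simp add: mult_right_mono)
    qed
    show "0 \<le> \<bar>deriv \<psi> x1\<bar>" by simp
    show "dist (\<psi> x) (\<psi> y) \<le> \<bar>deriv \<psi> x1\<bar> * dist x y" if xy: "x \<in> K" "y \<in> K" "c x = c y" for x y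
    proof -
      obtain \<xi> where "\<xi> \<in> I (c x)" "dist (\<psi> x) (\<psi> y) = \<bar>deriv \<psi> \<xi>\<bar> * dist x y"
        using mvt[OF cK[OF xy(1)] cK(2)[OF xy(2), folded xy(3)]] by blast
      then show ?thesis using x1(2)[of \<xi>] IU[OF cK(1)[OF xy(1)]] by (simp add: mult_right_mono)
    qed
    show "0 \<le> H * 4 powr \<beta>" using H by simp
    show "0 < \<beta>" by fact
    show "dist (\<psi> x) (\<psi> y) * dist z w \<le> exp (H * 4 powr \<beta> * D powr \<beta>) * (dist x y * dist (\<psi> z) (\<psi> w))"
      if K4: "x \<in> K" "y \<in> K" "z \<in> K" "w \<in> K" and cc: "c y = c x" "c z = c x" "c w = c x"
        and d: "dist x y \<le> D" "dist x z \<le> D" "dist x w \<le> D" for x y z w D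
    proof -
      let ?i = "c x"
      have i: "?i < r" "x \<in> I ?i" "y \<in> I ?i" "z \<in> I ?i" "w \<in> I ?i"
        using cK[OF K4(1)] cK(2)[OF K4(2)] cK(2)[OF K4(3)] cK(2)[OF K4(4)] cc by simp_all
      obtain \<xi> where \<xi>: "\<xi> \<in> I ?i" "dist \<xi> x \<le> dist x y" "dist (\<psi> x) (\<psi> y) = \<bar>deriv \<psi> \<xi>\<bar> * dist x y"
        using mvt[OF i(1,2,3)] by blast
      obtain \<zeta> where \<zeta>: "\<zeta> \<in> I ?i" "dist \<zeta> z \<le> dist z w" "dist (\<psi> z) (\<psi> w) = \<bar>deriv \<psi> \<zeta>\<bar> * dist z w"
        using mvt[OF i(1,4,5)] by blast
      \<comment> \<open>From \<xi> to x and from x to z it is at most D each, and from z to \<zeta>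
        at most dist z w \<le> 2 * D.\<close>
      have "dist \<xi> \<zeta> \<le> 4 * D"
        using \<xi>(2) \<zeta>(2) d unfolding dist_real_def by linarith
      then have "\<bar>\<xi> - \<zeta>\<bar> powr \<beta> \<le> (4 * D) powr \<beta>"
        using H by (intro powr_mono2) (auto simp: dist_real_def)
      also have "\<dots> = 4 powr \<beta> * D powr \<beta>"
        by (rule powr_mult)
      finally have h: "H * \<bar>\<xi> - \<zeta>\<bar> powr \<beta> \<le> H * 4 powr \<beta> * D powr \<beta>"
        using H by (simp add: mult_left_mono mult.assoc)
      let ?t = "H * 4 powr \<beta> * D powr \<beta>"
      have t0: "0 \<le> ?t" using H by simp
      have z1: "1 \<le> \<bar>deriv \<psi> \<zeta>\<bar>" using exp IU[OF i(1) \<zeta>(1)] UV by fastforce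
      \<comment> \<open>The additive Hoelder error becomes a factor because |deriv \<psi>| is at
        least 1 at \<zeta>.\<close>
      have "\<bar>deriv \<psi> \<xi>\<bar> \<le> \<bar>deriv \<psi> \<zeta>\<bar> + ?t"
        using hoelder'[OF i(1) \<xi>(1) \<zeta>(1)] h by linarith
      also have "\<dots> \<le> \<bar>deriv \<psi> \<zeta>\<bar> * (1 + ?t)"
        using mult_right_mono[OF z1 t0] by (simp add: distrib_left)
      also have "\<dots> \<le> \<bar>deriv \<psi> \<zeta>\<bar> * exp ?t"
        by (intro mult_left_mono exp_ge_add_one_self) auto
      finally have "\<bar>deriv \<psi> \<xi>\<bar> * (dist x y * dist z w) \<le> \<bar>deriv \<psi> \<zeta>\<bar> * exp ?t * (dist x y * dist z w)"
        by (intro mult_right_mono) auto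
      then show ?thesis by (simp add: \<xi>(3) \<zeta>(3) mult_ac)
    qed
    show "\<exists>u\<in>K. c u = c x \<and> \<psi> u = y" if xy: "x \<in> K" "y \<in> K" "c y = c (\<psi> x)" for x y
    proof -
      have i: "c x < r" "x \<in> I (c x)" by (rule cK[OF xy(1)])+
      obtain J where J: "J \<subseteq> {..<r}" "\<psi> ` I (c x) = convex hull (\<Union>j\<in>J. I j)"
        using hull i(1) by blast
      have "\<psi> x \<in> U" using xy(1) K_Suc KU by blast
      then have j: "c y < r" "\<psi> x \<in> I (c y)" "y \<in> I (c y)"
        using c[of "\<psi> x"] cK(2)[OF xy(2)] xy(3) by simp_all
      obtain a b where ab: "I (c y) = {a..b}" using I j(1) by blast
      \<comment> \<open>By disjointness the interval of y is one of those spanning the hull or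
        misses them all.\<close>
      have "(\<Union>j\<in>J. I j) \<inter> {a..b} = {} \<or> {a..b} \<subseteq> (\<Union>j\<in>J. I j)"
      proof (cases "c y \<in> J")
        case False
        have "I k \<inter> I (c y) = {}" if "k \<in> J" for k
        proof -
          have "k < r" "k \<noteq> c y" using that J(1) False by auto
          then show ?thesis using disj j(1) by (auto simp: disjoint_family_on_def)
        qed
        then show ?thesis using ab by blast
      qed (use ab in blast)
      moreover have "\<psi> x \<in> convex hull (\<Union>j\<in>J. I j)" using i(2) J(2) by blast
      ultimately have "y \<in> convex hull (\<Union>j\<in>J. I j)"
        using convex_hull_disjoint_interval j(2,3) ab by metis
      then obtain u where u: "u \<in> I (c x)" "\<psi> u = y" using J(2) by (metis imageE)
      then have "u \<in> K" using K_Suc IU i(1) xy(2) by blast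
      then show ?thesis using u c_eq[OF i(1)] by blast
    qed
    show "\<exists>u\<in>K. c u = c x \<and> (\<psi> ^^ m) u = y" if xy: "x \<in> K" "y \<in> K" for x y
    proof -
      have "c x < r" by (rule cK(1)[OF xy(1)])
      then have "y \<in> (\<psi> ^^ m) ` (K \<inter> I (c x))" using m xy(2) by simp
      then obtain u where u: "u \<in> K" "u \<in> I (c x)" "y = (\<psi> ^^ m) u" by (elim imageE IntE)
      then show ?thesis using c_eq[OF \<open>c x < r\<close> u(2)] by (intro bexI[of _ u]) simp_all
    qed
  qed
  then show ?thesis using that compact_K Kne by blast
qed

section \<open>Products and projections\<close>

text \<open>A separated set with the most points, which exists because of the bound, is a net: an
  uncovered point could be added.\<close>

lemma separated_net:
  fixes X :: "'a::metric_space set"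
  assumes "0 < \<rho>" and bound: "\<And>S. finite S \<Longrightarrow> S \<subseteq> X \<Longrightarrow> separated \<rho> S \<Longrightarrow> real (card S) \<le> B"
  obtains S where "finite S" "S \<subseteq> X" "separated \<rho> S" "X \<subseteq> (\<Union>x\<in>S. cball x \<rho>)"
proof -
  define P where "P S \<longleftrightarrow> finite S \<and> S \<subseteq> X \<and> separated \<rho> S" for S
  have "P {}" by (simp add: P_def separated_def)
  moreover have "\<forall>S. P S \<longrightarrow> card S < Suc (nat \<lfloor>B\<rfloor>)"
    using bound by (auto simp: P_def less_Suc_eq_le le_nat_floor)
  ultimately obtain S where S: "P S" "\<And>T. P T \<Longrightarrow> card T \<le> card S"
    using ex_has_greatest_nat[of P "{}" card] by blast
  have "x \<in> (\<Union>y\<in>S. cball y \<rho>)" if x: "x \<in> X" for x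
  proof (rule ccontr)
    assume far: "x \<notin> (\<Union>y\<in>S. cball y \<rho>)"
    then have "x \<notin> S" using assms(1) by auto
    moreover have "P (insert x S)"
      using S(1) x far by (auto simp: P_def separated_def dist_commute less_imp_le not_le)
    ultimately show False using S(2)[of "insert x S"] S(1) by (simp add: P_def)
  qed
  then show ?thesis using that S(1) unfolding P_def by blast
qed

lemma diameter_cball_Times_le:
  fixes x :: "'a::real_normed_vector" and y :: "'b::real_normed_vector"
  assumes "0 \<le> \<rho>"
  shows "bounded (cball x \<rho> \<times> cball y \<rho>)" "diameter (cball x \<rho> \<times> cball y \<rho>) \<le> 4 * \<rho>"
proof -
  show "bounded (cball x \<rho> \<times> cball y \<rho>)" by (intro bounded_Times bounded_cball)
  show "diameter (cball x \<rho> \<times> cball y \<rho>) \<le> 4 * \<rho>"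
  proof (rule diameter_le)
    show "cball x \<rho> \<times> cball y \<rho> \<noteq> {} \<or> 0 \<le> 4 * \<rho>" using assms by simp
    fix p q assume "p \<in> cball x \<rho> \<times> cball y \<rho>" "q \<in> cball x \<rho> \<times> cball y \<rho>"
    then have d: "dist x (fst p) \<le> \<rho>" "dist x (fst q) \<le> \<rho>" "dist y (snd p) \<le> \<rho>" "dist y (snd q) \<le> \<rho>"
      by auto
    have "dist p q \<le> dist (fst p) (fst q) + dist (snd p) (snd q)"
      unfolding dist_prod_def by (intro sqrt_sum_squares_le_sum) auto
    also have "dist (fst p) (fst q) \<le> 2 * \<rho>"
      using d dist_triangle3[of "fst p" "fst q" x] by simp
    also have "dist (snd p) (snd q) \<le> 2 * \<rho>"
      using d dist_triangle3[of "snd p" "snd q" y] by simp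
    finally show "norm (p - q) \<le> 4 * \<rho>" by (simp add: dist_norm)
  qed
qed

text \<open>At a common scale \<rho>, at most C1 * C2 * (2 R / \<rho>)^(s1 + s2) products of balls
  cover, each of diameter at most 4 \<rho>. The scale cancels and (8 R)^(s1 + s2) remains.\<close>

lemma hausdorff_outer_Times_cball_le:
  fixes K1 :: "'a::real_normed_vector set" and K2 :: "'b::real_normed_vector set"
  assumes K1: "assouad_bound C1 s1 K1" and K2: "assouad_bound C2 s2 K2"
    and C: "0 \<le> C1" "0 \<le> C2" and s: "0 < s1 + s2" and R: "0 < R"
  shows "hausdorff_outer (s1 + s2) ((K1 \<times> K2) \<inter> cball z R) \<le> ennreal (C1 * C2 * 8 powr (s1 + s2) * R powr (s1 + s2))"
proof -
  have "hausdorff_content (s1 + s2) \<epsilon> ((K1 \<times> K2) \<inter> cball z R) \<le> ennreal (C1 * C2 * 8 powr (s1 + s2) * R powr (s1 + s2))"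
    if "\<epsilon> > 0" for \<epsilon>
  proof -
    \<comment> \<open>Points of a ball of radius R are up to 2 R apart, and the counting bound
      requires \<rho> to be no larger; \<epsilon> / 5 makes 4 \<rho> strictly less than
      \<epsilon>.\<close>
    define \<rho> where "\<rho> = min (2 * R) (\<epsilon> / 5)"
    have \<rho>: "0 < \<rho>" "\<rho> \<le> 2 * R" "4 * \<rho> < \<epsilon>" using that R by (auto simp: \<rho>_def min_def)
    define X1 where "X1 = K1 \<inter> cball (fst z) R"
    define X2 where "X2 = K2 \<inter> cball (snd z) R"
    have b1: "real (card S) \<le> C1 * (2 * R / \<rho>) powr s1" if S: "finite S" "S \<subseteq> X1" "separated \<rho> S" for S
    proof (rule assouad_boundD[OF K1 S(1) _ S(3) \<rho>(1,2)])
      fix x y assume "x \<in> S" "y \<in> S"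
      then have "dist (fst z) x \<le> R" "dist (fst z) y \<le> R" using S(2) by (auto simp: X1_def)
      then show "dist x y \<le> 2 * R" using dist_triangle3[of x y "fst z"] by simp
    qed (use S(2) in \<open>auto simp: X1_def\<close>)
    have b2: "real (card S) \<le> C2 * (2 * R / \<rho>) powr s2" if S: "finite S" "S \<subseteq> X2" "separated \<rho> S" for S
    proof (rule assouad_boundD[OF K2 S(1) _ S(3) \<rho>(1,2)])
      fix x y assume "x \<in> S" "y \<in> S"
      then have "dist (snd z) x \<le> R" "dist (snd z) y \<le> R" using S(2) by (auto simp: X2_def)
      then show "dist x y \<le> 2 * R" using dist_triangle3[of x y "snd z"] by simp
    qed (use S(2) in \<open>auto simp: X2_def\<close>)
    obtain S1 where S1: "finite S1" "S1 \<subseteq> X1" "separated \<rho> S1" "X1 \<subseteq> (\<Union>x\<in>S1. cball x \<rho>)"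
      using separated_net[OF \<rho>(1) b1] by blast
    obtain S2 where S2: "finite S2" "S2 \<subseteq> X2" "separated \<rho> S2" "X2 \<subseteq> (\<Union>x\<in>S2. cball x \<rho>)"
      using separated_net[OF \<rho>(1) b2] by blast
    have cov: "(K1 \<times> K2) \<inter> cball z R \<subseteq> (\<Union>w\<in>S1 \<times> S2. cball (fst w) \<rho> \<times> cball (snd w) \<rho>)"
    proof
      fix p assume p: "p \<in> (K1 \<times> K2) \<inter> cball z R"
      have "dist (fst z) (fst p) \<le> dist z p" "dist (snd z) (snd p) \<le> dist z p"
        by (rule dist_fst_le dist_snd_le)+
      then have "fst p \<in> X1" "snd p \<in> X2" using p by (auto simp: X1_def X2_def)
      then obtain x y where "x \<in> S1" "fst p \<in> cball x \<rho>" "y \<in> S2" "snd p \<in> cball y \<rho>"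
        using S1(4) S2(4) by blast
      then show "p \<in> (\<Union>w\<in>S1 \<times> S2. cball (fst w) \<rho> \<times> cball (snd w) \<rho>)"
        by (intro UN_I[of "(x, y)"]) (auto simp: mem_Times_iff)
    qed
    have "hausdorff_content (s1 + s2) \<epsilon> ((K1 \<times> K2) \<inter> cball z R)
        \<le> ennreal (real (card (S1 \<times> S2)) * (4 * \<rho>) powr (s1 + s2))"
    proof (rule hausdorff_content_le_card[OF _ cov])
      show "bounded (cball (fst w) \<rho> \<times> cball (snd w) \<rho>)"
        "diameter (cball (fst w) \<rho> \<times> cball (snd w) \<rho>) \<le> 4 * \<rho>" for w :: "'a \<times> 'b"
        using \<rho>(1) by (intro diameter_cball_Times_le less_imp_le; simp)+
    qed (use S1 S2 s \<rho> in auto)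
    also have "\<dots> \<le> ennreal (C1 * C2 * 8 powr (s1 + s2) * R powr (s1 + s2))"
    proof (rule ennreal_leI)
      have "real (card (S1 \<times> S2)) * (4 * \<rho>) powr (s1 + s2)
          \<le> ((C1 * (2 * R / \<rho>) powr s1) * (C2 * (2 * R / \<rho>) powr s2)) * (4 * \<rho>) powr (s1 + s2)"
        unfolding card_cartesian_product of_nat_mult
        using S1 S2 b1 b2 C by (intro mult_right_mono mult_mono) auto
      also have "\<dots> = C1 * C2 * ((2 * R / \<rho>) powr (s1 + s2) * (4 * \<rho>) powr (s1 + s2))"
        by (simp add: powr_add)
      also have "(2 * R / \<rho>) powr (s1 + s2) * (4 * \<rho>) powr (s1 + s2) = (8 * R) powr (s1 + s2)"
      proof -
        have "8 * R = (2 * R / \<rho>) * (4 * \<rho>)" using \<rho> by simp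
        then show ?thesis by (simp only: powr_mult)
      qed
      finally show "real (card (S1 \<times> S2)) * (4 * \<rho>) powr (s1 + s2) \<le> C1 * C2 * 8 powr (s1 + s2) * R powr (s1 + s2)"
        by (simp add: powr_mult mult.assoc)
    qed
    finally show ?thesis .
  qed
  then show ?thesis unfolding hausdorff_outer_eq_SUP by (intro SUP_least) auto
qed

theorem proposition4p2:
  fixes K1 K2 :: "real set" and \<alpha> d :: real
  assumes "\<alpha> > 0"
    and "regular_cantor_set \<alpha> K1"
    and "regular_cantor_set \<alpha> K2"
    and "d = hausdorff_dim K1 + hausdorff_dim K2"
    and "d > 1"
  shows "AE \<theta> in lborel.
    absolutely_continuous (line_lebesgue \<theta>) (projected_measure d (K1 \<times> K2) \<theta>)"
proof -
  have cantor: "\<exists>C\<ge>0. assouad_bound C (hausdorff_dim K) K" and compact: "compact K" and unit: "K \<subseteq> {0..1}"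
    if reg: "regular_cantor_set \<alpha> K" for K
  proof -
    obtain f c \<delta> \<gamma> L A \<beta> m where K: "compact K" "K \<noteq> {}" "markov_system K f c \<delta> \<gamma> L A \<beta> m"
      using regular_cantor_set_markov_system[OF reg assms(1)] .
    interpret markov_system K f c \<delta> \<gamma> L A \<beta> m by (rule K(3))
    show "\<exists>C\<ge>0. assouad_bound C (hausdorff_dim K) K"
      using assouad_bound_hausdorff_dim[OF K(1,2)] by metis
    show "compact K" "K \<subseteq> {0..1}" by (rule K(1) K_unit)+
  qed
  obtain C1 where C1: "0 \<le> C1" "assouad_bound C1 (hausdorff_dim K1) K1"
    using cantor[OF assms(2)] by metis
  obtain C2 where C2: "0 \<le> C2" "assouad_bound C2 (hausdorff_dim K2) K2"
    using cantor[OF assms(3)] by metis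
  define E where "E = K1 \<times> K2"
  define C where "C = C1 * C2 * 8 powr d"
  have C0: "0 \<le> C" using C1(1) C2(1) by (simp add: C_def)
  have "compact E" unfolding E_def using assms(2,3) by (intro compact_Times compact)
  then have E: "E \<in> sets borel" by (intro borel_closed compact_imp_closed)
  have frost: "hausdorff_outer d (E \<inter> cball z R) \<le> ennreal (C * R powr d)" if "0 < R" for z R
    unfolding E_def C_def assms(4)
    by (rule hausdorff_outer_Times_cball_le[OF C1(2) C2(2)]) (use C1(1) C2(1) assms(4,5) that in auto)
  \<comment> \<open>A density on the plane instead of \<open>restrict_space\<close>: its measurable
    sets are then all Borel sets of the plane, as \<open>AE_absolutely_continuous_projection\<close>
    asks.\<close>
  define \<nu> where "\<nu> = density (hausdorff_measure d) (indicator E)"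
  have sets_\<nu>: "sets \<nu> = sets borel" by (simp add: \<nu>_def)
  have \<nu>: "emeasure \<nu> B = hausdorff_outer d (E \<inter> B)" if "B \<in> sets borel" for B
  proof -
    have "emeasure \<nu> B = (\<integral>\<^sup>+x. indicator E x * indicator B x \<partial>hausdorff_measure d)"
      unfolding \<nu>_def using E that by (intro emeasure_density) auto
    also have "\<dots> = (\<integral>\<^sup>+x. indicator (E \<inter> B) x \<partial>hausdorff_measure d)"
      by (intro nn_integral_cong) (simp add: indicator_inter_arith)
    also have "\<dots> = hausdorff_outer d (E \<inter> B)"
      using E that by (subst nn_integral_indicator) (auto simp: emeasure_hausdorff_measure)
    finally show ?thesis .
  qed
  \<comment> \<open>The growth bound for this single ball gives finiteness of the measure.\<close>
  have "E \<subseteq> cball 0 2"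
  proof
    fix p assume "p \<in> E"
    then have "fst p \<in> {0..1}" "snd p \<in> {0..1}"
      using unit[OF assms(2)] unit[OF assms(3)] by (auto simp: E_def)
    then have "norm (fst p) \<le> 1" "norm (snd p) \<le> 1" by auto
    then have "norm p \<le> 2" using norm_Pair_le[of "fst p" "snd p"] by simp
    then show "p \<in> cball 0 2" by simp
  qed
  then have "emeasure \<nu> UNIV = hausdorff_outer d (E \<inter> cball 0 2)"
    by (simp add: \<nu> Int_absorb2)
  also have "\<dots> < top" using frost[of 2 0] by (simp add: le_less_trans)
  finally have fin: "finite_measure \<nu>"
    using sets_eq_imp_space_eq[OF sets_\<nu>] by (intro finite_measureI) simp
  have "AE \<theta> in lborel. absolutely_continuous lborel (distr \<nu> borel (\<lambda>x. x \<bullet> (cos \<theta>, sin \<theta>)))"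
    by (rule AE_absolutely_continuous_projection[OF fin sets_\<nu> C0 assms(5)]) (simp add: \<nu> frost)
  then show ?thesis
  proof eventually_elim
    case (elim \<theta>)
    show ?case
      unfolding absolutely_continuous_def
    proof
      fix B assume B: "B \<in> null_sets (line_lebesgue \<theta>)"
      have Bs: "B \<in> sets (line_borel \<theta>)" using B by (auto simp: line_lebesgue_def)
      \<comment> \<open>The isometry carries the problem to the real line: a point projects into B
        exactly if its coordinate along \<open>unit_dir \<theta>\<close> lies in
        \<open>?T\<close>.\<close>
      let ?T = "{t. t *\<^sub>R unit_dir \<theta> \<in> B}"
      have meas: "(\<lambda>t. t *\<^sub>R unit_dir \<theta>) \<in> borel \<rightarrow>\<^sub>M line_borel \<theta>"
        unfolding line_borel_def
        by (intro measurable_restrict_space2) (auto simp: line_dir_def span_base span_scale)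
      have T: "?T \<in> sets borel" using measurable_sets[OF meas Bs] by (simp add: vimage_def)
      have "emeasure lborel ?T = 0"
        using B emeasure_line_lebesgue[OF Bs] by (simp add: null_sets_def)
      then have "?T \<in> null_sets lborel" using T by (simp add: null_sets_def)
      then have "emeasure (distr \<nu> borel (\<lambda>x. x \<bullet> (cos \<theta>, sin \<theta>))) ?T = 0"
        using elim by (auto simp: absolutely_continuous_def)
      moreover have "(\<lambda>x. x \<bullet> (cos \<theta>, sin \<theta>)) \<in> \<nu> \<rightarrow>\<^sub>M borel"
        by (simp add: measurable_cong_sets[OF sets_\<nu> refl])
      ultimately have "emeasure \<nu> ((\<lambda>x. x \<bullet> (cos \<theta>, sin \<theta>)) -` ?T) = 0"
        using T sets_eq_imp_space_eq[OF sets_\<nu>] by (simp add: emeasure_distr)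
      moreover have "(\<lambda>x. x \<bullet> (cos \<theta>, sin \<theta>)) -` ?T = proj_line \<theta> -` B"
        by (auto simp: proj_line_def unit_dir_def)
      moreover have "(\<lambda>x. x \<bullet> (cos \<theta>, sin \<theta>)) -` ?T \<in> sets borel"
        using measurable_sets[OF _ T, of "\<lambda>x. x \<bullet> (cos \<theta>, sin \<theta>)" borel] by simp
      ultimately have "hausdorff_outer d (E \<inter> proj_line \<theta> -` B) = 0" by (simp add: \<nu>)
      then show "B \<in> null_sets (projected_measure d (K1 \<times> K2) \<theta>)"
        using emeasure_projected_measure[OF E Bs] Bs
        by (simp add: null_sets_def E_def projected_measure_def)
    qed
  qed
qed

end
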